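(* Let $g\in G$ and $Y=\Gamma gU\subset X$. The orbit $Y$ is compact if and only if $g\infty\in\mathbb P^1(\mathbb F_q(t))$. If $Y$ is compact, its parameter stabilizer $$\Lambda_U(Y):=\{s\in F:\Gamma gu(s)=\Gamma g\}$$ is independent of the representative and of the base point chosen on $Y$. It has covolume $q^{-2m-1}$ for a unique integer $m=m(Y)$, and for this integer $$(h_K)_*\nu_Y=(h_K)_*\nu_{Y_m},\qquad Y_m:=\Gamma a_mU.$$ More precisely, $m=-v_\infty(r)$, where one can write $$\gamma^{-1}g=d(r)u(s_0)=a_m\,d(\eta)\,u(s_0)$$ for some $\gamma\in\Gamma$, $r\in F^\times$, $\eta\in\mathcal O^\times$, and $s_0\in F$.
   Context: Let $q$ be a prime power, $F=\mathbb F_q((t^{-1}))$, $\mathcal O=\mathbb F_q[[t^{-1}]]$, $\pi=t^{-1}$, $v_\infty$ the valuation on $F$ with $v_\infty(\pi)=1$, $G=\mathrm{SL}_2(F)$, $\Gamma=\mathrm{SL}_2(\mathbb F_q[t])$, $K=\mathrm{SL}_2(\mathcal O)$, $X=\Gamma\backslash G$. Put $u(s)=\begin{pmatrix}1&s\\0&1\end{pmatrix}$, $U=\{u(s):s\in F\}$ acting on $X$ on the right, $d(r)=\mathrm{diag}(r,r^{-1})$ for $r\in F^\times$, $a_n=\mathrm{diag}(t^n,t^{-n})$ for $n\in\mathbb Z$. $G$ acts on $\mathbb P^1(F)$, $\infty=[1:0]$. Haar measure $ds$ on $F$ is normalized by $ds(\mathcal O)=1$, and covolumes in $F$ are taken with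 respect to it. For a compact orbit $Y$, $\nu_Y$ is the normalized $U$-invariant probability measure on $Y$. Height map: $\mathcal T$ is the Bruhat--Tits tree of $\mathrm{PGL}_2(F)$ (vertices: homothety classes of $\mathcal O$-lattices in $F^2$; $[L],[L']$ adjacent if representatives satisfy $\pi L\subsetneq L'\subsetneq L$, $L/L'\simeq\mathbb F_q$). With $v_n=[\mathrm{diag}(t^n,1)]\cdot[\mathcal O^2]$, the quotient of $\mathcal T$ by $\mathrm{PGL}_2(\mathbb F_q[t])$ is the ray $v_0-v_1-\cdots$, and $h(v)$ is the $n\ge0$ for which $v$ lies in the orbit of $v_n$. $h_K:X\to2\mathbb Z_{\ge0}$, $h_K(\Gamma g)=h(gv_0)$. *)

theory Defs
  imports "HOL-Probability.Probability" "HOL-Computational_Algebra.Formal_Laurent_Series"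
begin

text \<open>
  A finite field of order \<open>q\<close> is a type \<open>'a :: {field, finite}\<close> with \<open>q = CARD('a)\<close>.  The field
  \<open>F\<close> of formal Laurent series in \<open>\<pi> = 1/t\<close> is \<open>'a fls\<close>, so that \<open>fls_X\<close> is \<open>\<pi>\<close>, \<open>fls_X_inv\<close> is
  \<open>t\<close>, and \<open>fls_subdegree\<close> is the valuation at infinity on nonzero elements (the library sets
  \<open>fls_subdegree 0 = 0\<close>).  The library metric on \<open>'a fls\<close> is \<open>2\<close> to the power of minus the valuation
  of the difference, so it induces the usual topology of the local field \<open>F\<close>.
\<close>

subsection \<open>Rings and matrices\<close>

abbreviation tvar :: "'a::field fls" where
  "tvar \<equiv> fls_X_inv"

definition integers_O :: "'a::field fls set" where
  "integers_O = range fps_to_fls"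

definition poly_ring :: "'a::field fls set" where
  "poly_ring = range (\<lambda>p :: 'a poly. poly (map_poly fls_const p) tvar)"

definition rat_field :: "'a::field fls set" where
  "rat_field = {a / b | a b. a \<in> poly_ring \<and> b \<in> poly_ring \<and> b \<noteq> 0}"

definition ring_units :: "'b::comm_ring_1 set \<Rightarrow> 'b set" where
  "ring_units R = {x \<in> R. \<exists>y\<in>R. x * y = 1}"

definition mat2 :: "'b::zero \<Rightarrow> 'b \<Rightarrow> 'b \<Rightarrow> 'b \<Rightarrow> 'b^2^2" where
  "mat2 a b c d = vector [vector [a, b], vector [c, d]]"

definition SL2 :: "'b::comm_ring_1 set \<Rightarrow> ('b^2^2) set" where
  "SL2 R = {A. (\<forall>i j. A $ i $ j \<in> R) \<and> det A = 1}"

definition GL2 :: "'b::comm_ring_1 set \<Rightarrow> ('b^2^2) set" where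
  "GL2 R = {A. (\<forall>i j. A $ i $ j \<in> R) \<and> det A \<in> ring_units R}"

abbreviation G :: "('a::field fls^2^2) set" where
  "G \<equiv> SL2 UNIV"

abbreviation Gam :: "('a::field fls^2^2) set" where
  "Gam \<equiv> SL2 poly_ring"

definition u_mat :: "'a::field fls \<Rightarrow> 'a fls^2^2" where
  "u_mat s = mat2 1 s 0 1"

definition d_mat :: "'a::field fls \<Rightarrow> 'a fls^2^2" where
  "d_mat r = mat2 r 0 0 (inverse r)"

definition a_mat :: "int \<Rightarrow> 'a::field fls^2^2" where
  "a_mat n = mat2 (tvar powi n) 0 0 (tvar powi (- n))"

subsection \<open>The projective line\<close>

text \<open>Points are the sets \<open>F\<^sup>\<times> v\<close> with \<open>v \<noteq> 0\<close>.\<close>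

definition proj_point :: "'a::field fls^2 \<Rightarrow> ('a fls^2) set" where
  "proj_point v = {c *s v | c. c \<noteq> 0}"

definition proj_line :: "'a::field fls set \<Rightarrow> ('a fls^2) set set" where
  "proj_line k = {proj_point v | v. v \<noteq> 0 \<and> (\<forall>i. v $ i \<in> k)}"

definition proj_infty :: "('a::field fls^2) set" where
  "proj_infty = proj_point (vector [1, 0])"

definition proj_act :: "'a::field fls^2^2 \<Rightarrow> ('a fls^2) set \<Rightarrow> ('a fls^2) set" where
  "proj_act g p = (\<lambda>v. g *v v) ` p"

subsection \<open>The quotient space and horocyclic orbits\<close>

definition coset :: "'a::field fls^2^2 \<Rightarrow> ('a fls^2^2) set" where
  "coset g = (\<lambda>\<gamma>. \<gamma> ** g) ` Gam"

definition right_act :: "('a::field fls^2^2) set \<Rightarrow> 'a fls^2^2 \<Rightarrow> ('a fls^2^2) set" where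
  "right_act x h = (\<lambda>y. y ** h) ` x"

text \<open>The quotient topology on \<open>coset ` G\<close>.\<close>

definition X_top :: "('a::field fls^2^2) set topology" where
  "X_top = topology (\<lambda>V. V \<subseteq> coset ` G \<and> openin (top_of_set G) {g \<in> G. coset g \<in> V})"

definition U_orbit :: "'a::field fls^2^2 \<Rightarrow> ('a fls^2^2) set set" where
  "U_orbit g = range (\<lambda>s. coset (g ** u_mat s))"

definition param_stab :: "'a::field fls^2^2 \<Rightarrow> 'a fls set" where
  "param_stab g = {s. coset (g ** u_mat s) = coset g}"

subsection \<open>Measures\<close>

definition normalized_haar :: "'a::field fls measure \<Rightarrow> bool" where
  "normalized_haar \<mu> \<longleftrightarrow>
     sets \<mu> = sets borel \<and>
     (\<forall>s. \<forall>A \<in> sets \<mu>. emeasure \<mu> ((+) s ` A) = emeasure \<mu> A) \<and>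
     emeasure \<mu> integers_O = 1"

definition fundamental_domain :: "'a::field fls set \<Rightarrow> 'a fls set \<Rightarrow> bool" where
  "fundamental_domain \<Lambda> D \<longleftrightarrow> D \<in> sets borel \<and> (\<forall>s. \<exists>!d. d \<in> D \<and> s - d \<in> \<Lambda>)"

text \<open>The first conjunct excludes the vacuous case of a subgroup without Borel fundamental domain.\<close>

definition has_covolume :: "'a::field fls measure \<Rightarrow> 'a fls set \<Rightarrow> ennreal \<Rightarrow> bool" where
  "has_covolume \<mu> \<Lambda> c \<longleftrightarrow>
     (\<exists>D. fundamental_domain \<Lambda> D) \<and> (\<forall>D. fundamental_domain \<Lambda> D \<longrightarrow> emeasure \<mu> D = c)"

text \<open>\<open>U\<close>-invariant probability measures on the Borel sets of a \<open>U\<close>-orbit \<open>Y\<close> in \<open>X\<close>.\<close>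

definition U_invariant_prob ::
    "('a::field fls^2^2) set set \<Rightarrow> ('a fls^2^2) set measure \<Rightarrow> bool" where
  "U_invariant_prob Y \<nu> \<longleftrightarrow>
     prob_space \<nu> \<and>
     space \<nu> = Y \<and>
     sets \<nu> = sigma_sets Y {V. openin (subtopology X_top Y) V} \<and>
     (\<forall>s. \<forall>A \<in> sets \<nu>. emeasure \<nu> ((\<lambda>x. right_act x (u_mat s)) ` A) = emeasure \<nu> A)"

subsection \<open>The height map\<close>

text \<open>
  Vertices of the Bruhat--Tits tree are homothety classes of \<open>\<O>\<close>-lattices in \<open>F\<^sup>2\<close>, a lattice being
  a set of vectors.  Scalar matrices act trivially on homothety classes and every class in
  \<open>PGL\<^sub>2\<close> of the polynomial ring lifts to \<open>GL\<^sub>2\<close>, so both groups have the same orbits of vertices.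
\<close>

definition homothety_class :: "('a::field fls^2) set \<Rightarrow> ('a fls^2) set set" where
  "homothety_class L = {(\<lambda>v. c *s v) ` L | c. c \<noteq> 0}"

definition vertex_act ::
    "'a::field fls^2^2 \<Rightarrow> ('a fls^2) set set \<Rightarrow> ('a fls^2) set set" where
  "vertex_act g v = (\<lambda>L. (\<lambda>x. g *v x) ` L) ` v"

definition ray_vertex :: "nat \<Rightarrow> ('a::field fls^2) set set" where
  "ray_vertex n =
     vertex_act (mat2 (tvar ^ n) 0 0 1) (homothety_class {x. \<forall>i. x $ i \<in> integers_O})"

definition height :: "('a::field fls^2) set set \<Rightarrow> nat" where
  "height v = (THE n. \<exists>\<gamma>\<in>GL2 poly_ring. v = vertex_act \<gamma> (ray_vertex n))"

definition height_K :: "('a::field fls^2^2) set \<Rightarrow> nat" where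
  "height_K x = (THE n. \<exists>g\<in>G. x = coset g \<and> n = height (vertex_act g (ray_vertex 0)))"

end

theory Submission
  imports Defs
begin

(* Reserves the dollar sign for the components of vectors. *)
no_notation fps_nth (infixl "$" 75)

text \<open>
  Write \<open>P\<close> for the polynomial ring \<open>poly_ring\<close>, \<open>O\<close> for \<open>integers_O\<close>, \<open>K = SL2 O\<close>, and
  \<open>frac_ideal n\<close> for the ball of Laurent series of valuation at least \<open>n\<close>.  Everything rests on the
  decomposition \<open>F = P \<oplus> frac_ideal 1\<close>: a Laurent series in \<open>1/t\<close> is a polynomial in \<open>t\<close> plus a
  series without constant term.

  \<^emph>\<open>Normal form.\<close>  If \<open>g \<infinity>\<close> is rational, its first column is proportional to a vector of
  polynomials.  The Euclidean algorithm (division with remainder is the decomposition above) moves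
  this vector onto the first coordinate axis by an element of \<open>Gam\<close>, which leaves a triangular matrix
  \<open>d(r) u(s\<^sub>0)\<close> (\<open>rational_decomposition\<close>).  Thus the orbit is \<open>\<Gamma> d(r) U\<close>, its parameter stabilizer is
  \<open>r\<^sup>-\<^sup>2 P\<close>, and scaling the decomposition by \<open>r\<^sup>-\<^sup>2\<close> shows that \<open>frac_ideal (1 - 2 v(r))\<close> is a
  fundamental domain (\<open>param_stab_complement\<close>).

  \<^emph>\<open>Compactness.\<close>  That fundamental domain is compact and surjects onto the orbit, so the orbit is
  compact.  Conversely, a compact orbit lies in one of the open sets of lattices that have no vector
  shorter than a fixed bound (\<open>compact_orbit_no_short_vector\<close>), since these sets form an increasing
  cover of \<open>X\<close>.  If \<open>g \<infinity>\<close> were irrational, a Dirichlet argument would give polynomials \<open>p\<close>, \<open>q\<close> for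
  which \<open>p g\<^sub>1\<^sub>1 + q g\<^sub>2\<^sub>1\<close> is nonzero and as small as desired; a suitable \<open>u(s)\<close> kills the other
  coordinate of that lattice vector, and the orbit would contain lattices with arbitrarily short vectors
  (\<open>compact_orbit_rational\<close>).

  \<^emph>\<open>Covolume.\<close>  With \<open>m = - v(r)\<close> the fundamental domain is \<open>frac_ideal (2 m + 1)\<close>, which has Haar
  measure \<open>q\<^sup>-\<^sup>2\<^sup>m\<^sup>-\<^sup>1\<close> because each ball is the disjoint union of \<open>q\<close> translates of the next smaller one.
  The stabilizer is countable, so all its Borel fundamental domains have the same measure.

  \<^emph>\<open>Distribution of the height.\<close>  The height is right \<open>K\<close>-invariant.  Along the orbit it is therefore
  a function of \<open>s\<close> modulo \<open>\<Lambda> + O\<close>, where \<open>\<Lambda>\<close> is the stabilizer and \<open>F / (\<Lambda> + O)\<close> is finite.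
  Averaging over a finite group of representatives turns the measure of a level set, for any
  \<open>U\<close>-invariant probability measure, into a proportion of representatives
  (\<open>invariant_prob_counting\<close>).  For \<open>r = t\<^sup>m \<eta>\<close> with a unit \<open>\<eta>\<close>, the rule
  \<open>d(\<eta>) u(\<eta>\<^sup>-\<^sup>2 s) = u(s) d(\<eta>)\<close> and \<open>d(\<eta>) \<in> K\<close> identify these proportions with the ones for \<open>a\<^sub>m\<close>
  (\<open>height_counting_formula\<close>), and so both pushforwards agree.
\<close>

section \<open>Fractional ideals and the polynomial ring\<close>

definition frac_ideal :: "int \<Rightarrow> 'a::field fls set" where
  "frac_ideal n = {x. \<forall>k<n. fls_nth x k = 0}"

text \<open>
  The alternative \<open>x = 0\<close> corrects the convention \<open>fls_subdegree 0 = 0\<close>.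
\<close>

lemma frac_ideal_iff: "x \<in> frac_ideal n \<longleftrightarrow> x = 0 \<or> n \<le> fls_subdegree x"
  unfolding frac_ideal_def
  by (auto intro: fls_subdegree_geI)

lemma frac_ideal_0 [simp]: "0 \<in> frac_ideal n"
  by (simp add: frac_ideal_def)

lemma frac_ideal_add: "x \<in> frac_ideal n \<Longrightarrow> y \<in> frac_ideal n \<Longrightarrow> x + y \<in> frac_ideal n"
  by (simp add: frac_ideal_def)

lemma frac_ideal_diff: "x \<in> frac_ideal n \<Longrightarrow> y \<in> frac_ideal n \<Longrightarrow> x - y \<in> frac_ideal n"
  by (simp add: frac_ideal_def)

lemma frac_ideal_mult: "x \<in> frac_ideal m \<Longrightarrow> y \<in> frac_ideal n \<Longrightarrow> x * y \<in> frac_ideal (m + n)"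
  by (cases "x = 0 \<or> y = 0") (auto simp: frac_ideal_iff)

lemma frac_ideal_antimono: "m \<le> n \<Longrightarrow> frac_ideal n \<subseteq> frac_ideal m"
  by (auto simp: frac_ideal_iff)

lemma frac_ideal_mult_iff:
  assumes "c \<noteq> 0" shows "c * x \<in> frac_ideal n \<longleftrightarrow> x \<in> frac_ideal (n - fls_subdegree c)"
  using assms by (cases "x = 0") (auto simp: frac_ideal_iff)

lemma one_in_frac_ideal [simp]: "1 \<in> frac_ideal n \<longleftrightarrow> n \<le> 0"
  by (auto simp: frac_ideal_iff)

lemma integers_O_eq: "integers_O = frac_ideal 0"
proof -
  have "x \<in> integers_O" if "x \<in> frac_ideal 0" for x :: "'a fls"
  proof -
    have "fls_subdegree x \<ge> 0" using that by (auto simp: frac_ideal_iff)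
    then have "x = fps_to_fls (fls_regpart x)" by simp
    then show ?thesis unfolding integers_O_def by blast
  qed
  then show ?thesis
    unfolding integers_O_def by (auto simp: frac_ideal_iff fls_subdegree_fls_to_fps_gt0)
qed

lemma ring_units_O_iff:
  "x \<in> ring_units integers_O \<longleftrightarrow> x \<noteq> 0 \<and> fls_subdegree x = 0"
proof
  assume "x \<in> ring_units integers_O"
  then obtain y where y: "x \<in> frac_ideal 0" "y \<in> frac_ideal 0" "x * y = 1"
    by (auto simp: ring_units_def integers_O_eq)
  then have nz: "x \<noteq> 0" "y \<noteq> 0" by auto
  then have "fls_subdegree x + fls_subdegree y = 0"
    using fls_subdegree_mult[OF nz] y(3) by simp
  then show "x \<noteq> 0 \<and> fls_subdegree x = 0" using y nz by (auto simp: frac_ideal_iff)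
next
  assume "x \<noteq> 0 \<and> fls_subdegree x = 0"
  then show "x \<in> ring_units integers_O"
    by (auto simp: ring_units_def integers_O_eq frac_ideal_iff
        intro!: bexI[of _ "inverse x"])
qed

text \<open>
  A polynomial in \<open>t\<close> is a series in \<open>1/t\<close> without terms of positive degree: a series has only finitely
  many terms of negative degree, and these are stripped off from the constant term on.  This description
  makes membership in \<open>poly_ring\<close> a condition on coefficients.
\<close>

lemma poly_ring_iff: "x \<in> poly_ring \<longleftrightarrow> (\<forall>k>0. fls_nth x k = 0)"
proof
  assume "x \<in> poly_ring"
  then obtain p where x: "x = poly (map_poly fls_const p) tvar" by (auto simp: poly_ring_def)
  have "\<forall>k>0. fls_nth (poly (map_poly fls_const p) tvar) k = 0"
    by (induction p) (auto simp: map_poly_pCons fls_X_inv_times_conv_shift)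
  then show "\<forall>k>0. fls_nth x k = 0" by (simp add: x)
next
  have *: "x \<in> poly_ring" if "\<forall>k. k > 0 \<or> k < - int n \<longrightarrow> fls_nth x k = 0" for n and x :: "'a fls"
    using that
  proof (induction n arbitrary: x)
    case 0
    then have "x = poly (map_poly fls_const [:fls_nth x 0:]) tvar"
      by (auto simp: fls_eq_iff map_poly_pCons) (metis linorder_neqE)
    then show ?case unfolding poly_ring_def by blast
  next
    case (Suc n)
    let ?y = "fls_shift (-1) (x - fls_const (fls_nth x 0))"
    have "\<forall>k. k > 0 \<or> k < - int n \<longrightarrow> fls_nth ?y k = 0"
      using Suc.prems by auto
    from Suc.IH[OF this] obtain p where p: "?y = poly (map_poly fls_const p) tvar"
      by (auto simp: poly_ring_def)
    have "x = poly (map_poly fls_const (pCons (fls_nth x 0) p)) tvar"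
      by (simp add: map_poly_pCons p[symmetric] fls_X_inv_times_conv_shift)
    then show ?case unfolding poly_ring_def by blast
  qed
  assume "\<forall>k>0. fls_nth x k = 0"
  then show "x \<in> poly_ring"
    by (intro *[of "nat (- fls_subdegree x)"]) auto
qed

lemma poly_ring_add: "x \<in> poly_ring \<Longrightarrow> y \<in> poly_ring \<Longrightarrow> x + y \<in> poly_ring"
  by (simp add: poly_ring_iff)

lemma poly_ring_diff: "x \<in> poly_ring \<Longrightarrow> y \<in> poly_ring \<Longrightarrow> x - y \<in> poly_ring"
  by (simp add: poly_ring_iff)

lemma poly_ring_uminus_iff [simp]: "- x \<in> poly_ring \<longleftrightarrow> x \<in> poly_ring"
  by (simp add: poly_ring_iff)

lemma poly_ring_0 [simp]: "0 \<in> poly_ring" and poly_ring_1 [simp]: "1 \<in> poly_ring"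
  by (simp_all add: poly_ring_iff)

lemma poly_ring_mult:
  assumes "x \<in> poly_ring" "y \<in> poly_ring" shows "x * y \<in> poly_ring"
proof -
  from assms(1) obtain p where x: "x = poly (map_poly fls_const p) tvar"
    by (auto simp: poly_ring_def)
  have "poly (map_poly fls_const p) tvar * y \<in> poly_ring"
  proof (induction p)
    case (pCons a p)
    have "poly (map_poly fls_const (pCons a p)) tvar * y =
        fls_const a * y + tvar * (poly (map_poly fls_const p) tvar * y)"
      by (simp add: map_poly_pCons ring_distribs mult.assoc)
    moreover have "fls_const a * y \<in> poly_ring" using assms(2) by (simp add: poly_ring_iff)
    moreover have "tvar * z \<in> poly_ring" if "z \<in> poly_ring" for z :: "'a fls"
      using that by (simp add: poly_ring_iff fls_X_inv_times_conv_shift)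
    ultimately show ?case using pCons.IH by (simp add: poly_ring_add)
  qed simp
  then show ?thesis by (simp add: x)
qed

lemma tvar_power_in_poly_ring [simp]: "tvar ^ n \<in> poly_ring"
  by (auto simp: poly_ring_iff)

lemma poly_ring_inter_frac_ideal_1: "x \<in> poly_ring \<Longrightarrow> x \<in> frac_ideal 1 \<Longrightarrow> x = 0"
  by (auto simp: poly_ring_iff frac_ideal_def fls_eq_iff) (metis zle_add1_eq_le linorder_not_le add.commute add_0)

text \<open>
  With the previous lemma, this is the direct decomposition of \<open>F\<close> into the polynomial part and the
  part of positive valuation.  It serves as division with remainder, as the source of fundamental
  domains, and as the integer part in Diophantine approximation.
\<close>

lemma poly_ring_plus_frac_ideal_1:
  obtains p f where "p \<in> poly_ring" "f \<in> frac_ideal 1" "x = p + f"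
proof -
  define f where "f = fps_to_fls (Abs_fps (\<lambda>n. if n = 0 then 0 else fls_nth x (int n)))"
  have "f \<in> frac_ideal 1" "x - f \<in> poly_ring"
    by (auto simp: f_def frac_ideal_def poly_ring_iff)
  then show ?thesis using that[of "x - f" f] by simp
qed

lemma finite_window: "finite {x::'a::{zero,finite} fls. \<forall>k. k \<notin> {a..b} \<longrightarrow> fls_nth x k = 0}"
proof -
  have "finite {f. \<forall>k. (k \<in> {a..b} \<longrightarrow> f k \<in> (UNIV::'a set)) \<and> (k \<notin> {a..b} \<longrightarrow> f k = 0)}"
    by (rule finite_set_of_finite_funs) auto
  then have "finite (fls_nth ` {x::'a fls. \<forall>k. k \<notin> {a..b} \<longrightarrow> fls_nth x k = 0})"
    by (rule finite_subset[rotated]) auto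
  then show ?thesis
    by (rule finite_imageD) (auto simp: inj_on_def fls_nth_inject)
qed

lemma countable_poly_ring: "countable (poly_ring :: 'a::{field,finite} fls set)"
proof -
  have "poly_ring \<subseteq> (\<Union>n::nat. {x::'a fls. \<forall>k. k \<notin> {- int n..0} \<longrightarrow> fls_nth x k = 0})"
  proof
    fix x :: "'a fls" assume "x \<in> poly_ring"
    moreover have "fls_nth x k = 0" if "k < - int (nat (- fls_subdegree x))" for k
      by (rule fls_eq0_below_subdegree) (use that in linarith)
    ultimately have "\<forall>k. k \<notin> {- int (nat (- fls_subdegree x))..0} \<longrightarrow> fls_nth x k = 0"
      unfolding poly_ring_iff atLeastAtMost_iff by (metis linorder_not_le)
    then show "x \<in> (\<Union>n::nat. {x::'a fls. \<forall>k. k \<notin> {- int n..0} \<longrightarrow> fls_nth x k = 0})" by blast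
  qed
  then show ?thesis
    by (rule countable_subset) (rule countable_UN, simp, rule countable_finite, rule finite_window)
qed

section \<open>The topology of the local field\<close>

text \<open>
  The metric takes the values \<open>2\<close> to the power of minus the valuation, so an open ball of radius
  \<open>2\<^sup>-\<^sup>n\<close> is the closed ball of the next valuation \<open>n + 1\<close>.
\<close>

lemma fls_dist_less_iff:
  fixes x y :: "'a::field fls"
  shows "dist y x < inverse (2 ^ n) \<longleftrightarrow> y - x \<in> frac_ideal (int n + 1)"
proof (cases "y = x")
  case False
  show ?thesis
  proof (cases "fls_subdegree (y - x) \<ge> 0")
    case True
    then obtain m where m: "fls_subdegree (y - x) = int m" using nonneg_int_cases by blast
    have "dist y x < inverse (2 ^ n) \<longleftrightarrow> inverse (2 ^ m) < inverse (2 ^ n :: real)"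
      using False by (simp add: dist_fls_def m)
    also have "\<dots> \<longleftrightarrow> n < m" by simp
    finally show ?thesis using False by (auto simp: frac_ideal_iff m)
  next
    case neg: False
    have "(1::real) \<le> 2 ^ nat (- fls_subdegree (y - x))" by simp
    moreover have "inverse (2 ^ n) \<le> (1::real)" by (simp add: field_simps)
    ultimately have "\<not> 2 ^ nat (- fls_subdegree (y - x)) < inverse (2 ^ n :: real)" by linarith
    then show ?thesis using False neg by (simp add: dist_fls_def frac_ideal_iff)
  qed
qed simp

text \<open>
  Replaces the metric by valuations; every topological argument below goes through this criterion.
\<close>

lemma open_fls_iff:
  fixes S :: "'a::field fls set"
  shows "open S \<longleftrightarrow> (\<forall>x\<in>S. \<exists>n. \<forall>y. y - x \<in> frac_ideal n \<longrightarrow> y \<in> S)"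
proof (intro iffI ballI)
  fix x assume "open S" "x \<in> S"
  then obtain r where r: "r > 0" "\<And>y. dist y x < r \<Longrightarrow> y \<in> S" by (auto simp: open_dist)
  from reals_power_lt_ex[of r 2] r(1) obtain n where n: "inverse (2 ^ n) < r"
    by (auto simp: power_one_over inverse_eq_divide)
  have "y \<in> S" if "y - x \<in> frac_ideal (int n + 1)" for y
    using that n r(2)[of y] unfolding fls_dist_less_iff[symmetric] by linarith
  then show "\<exists>n. \<forall>y. y - x \<in> frac_ideal n \<longrightarrow> y \<in> S" by blast
next
  assume *: "\<forall>x\<in>S. \<exists>n. \<forall>y. y - x \<in> frac_ideal n \<longrightarrow> y \<in> S"
  show "open S" unfolding open_dist
  proof
    fix x assume "x \<in> S"
    then obtain n where n: "\<And>y. y - x \<in> frac_ideal n \<Longrightarrow> y \<in> S" using * by blast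
    have "y \<in> S" if "dist y x < inverse (2 ^ nat n)" for y
    proof -
      have "n \<le> int (nat n) + 1" by linarith
      then show ?thesis
        using that frac_ideal_antimono by (auto simp: fls_dist_less_iff intro!: n)
    qed
    then show "\<exists>e>0. \<forall>y. dist y x < e \<longrightarrow> y \<in> S" by (intro exI[of _ "inverse (2 ^ nat n)"]) auto
  qed
qed

lemma open_translate_frac_ideal: "open {y::'a::field fls. y - x \<in> frac_ideal n}"
  unfolding open_fls_iff
proof (intro ballI exI allI impI CollectI)
  fix y z :: "'a fls" assume "y \<in> {y. y - x \<in> frac_ideal n}" "z - y \<in> frac_ideal n"
  then have "(z - y) + (y - x) \<in> frac_ideal n" by (intro frac_ideal_add) auto
  then show "z - x \<in> frac_ideal n" by simp
qed

lemma open_frac_ideal: "open (frac_ideal n :: 'a::field fls set)"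
  using open_translate_frac_ideal[of 0 n] by simp

lemma continuous_on_fls_affine:
  fixes c d :: "'a::field fls"
  shows "continuous_on UNIV (\<lambda>s. c * s + d)"
proof (cases "c = 0")
  case False
  have "open ((\<lambda>s. c * s + d) -` S)" if "open S" for S
    unfolding open_fls_iff
  proof
    fix x assume "x \<in> (\<lambda>s. c * s + d) -` S"
    with \<open>open S\<close> obtain n where n: "\<And>y. y - (c * x + d) \<in> frac_ideal n \<Longrightarrow> y \<in> S"
      unfolding open_fls_iff by blast
    have "y \<in> (\<lambda>s. c * s + d) -` S" if "y - x \<in> frac_ideal (n - fls_subdegree c)" for y
      using that frac_ideal_mult_iff[OF False, of "y - x" n]
      by (auto intro!: n simp: algebra_simps)
    then show "\<exists>n. \<forall>y. y - x \<in> frac_ideal n \<longrightarrow> y \<in> (\<lambda>s. c * s + d) -` S" by blast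
  qed
  then show ?thesis by (simp add: continuous_on_open_vimage)
qed simp

section \<open>Two-by-two matrices of determinant one\<close>

text \<open>
  The common closure properties of \<open>poly_ring\<close>, \<open>integers_O\<close> and the whole field, so that the group
  laws of \<open>SL2\<close> are proved once.
\<close>

definition is_subring :: "'b::comm_ring_1 set \<Rightarrow> bool" where
  "is_subring R \<longleftrightarrow> 1 \<in> R \<and> (\<forall>x\<in>R. \<forall>y\<in>R. x - y \<in> R \<and> x * y \<in> R)"

lemma is_subring_poly_ring: "is_subring poly_ring"
  by (simp add: is_subring_def poly_ring_diff poly_ring_mult)

lemma is_subring_integers_O: "is_subring integers_O"
  using frac_ideal_mult[where m = 0 and n = 0]
  by (auto simp: is_subring_def integers_O_eq frac_ideal_diff)

lemma is_subring_UNIV: "is_subring UNIV"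
  by (simp add: is_subring_def)

lemma is_subringD:
  assumes "is_subring R"
  shows "1 \<in> R" "0 \<in> R" "x \<in> R \<Longrightarrow> y \<in> R \<Longrightarrow> x - y \<in> R" "x \<in> R \<Longrightarrow> y \<in> R \<Longrightarrow> x * y \<in> R"
    "x \<in> R \<Longrightarrow> - x \<in> R" "x \<in> R \<Longrightarrow> y \<in> R \<Longrightarrow> x + y \<in> R"
proof -
  show 1: "1 \<in> R" and d: "\<And>x y. x \<in> R \<Longrightarrow> y \<in> R \<Longrightarrow> x - y \<in> R"
    and "x \<in> R \<Longrightarrow> y \<in> R \<Longrightarrow> x * y \<in> R"
    using assms by (auto simp: is_subring_def)
  show 0: "0 \<in> R" using d[OF 1 1] by simp
  show m: "\<And>x. x \<in> R \<Longrightarrow> - x \<in> R" using d[OF 0] by simp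
  show "x \<in> R \<Longrightarrow> y \<in> R \<Longrightarrow> x + y \<in> R" using d[OF _ m, of x y] by simp
qed

lemma mat2_nth [simp]:
  "mat2 a b c d $ 1 $ 1 = a" "mat2 a b c d $ 1 $ 2 = b"
  "mat2 a b c d $ 2 $ 1 = c" "mat2 a b c d $ 2 $ 2 = d"
  by (simp_all add: mat2_def)

lemma mat2_eta: "A = mat2 (A $ 1 $ 1) (A $ 1 $ 2) (A $ 2 $ 1) (A $ 2 $ 2)"
  by (simp add: vec_eq_iff forall_2)

lemma mat2_eq_iff [simp]: "mat2 a b c d = mat2 a' b' c' d' \<longleftrightarrow> a = a' \<and> b = b' \<and> c = c' \<and> d = d'"
  by (auto simp: vec_eq_iff forall_2)

lemma mat2_mult [simp]:
  fixes a :: "'b::comm_ring_1"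
  shows "mat2 a b c d ** mat2 a' b' c' d' =
    mat2 (a * a' + b * c') (a * b' + b * d') (c * a' + d * c') (c * b' + d * d')"
  by (simp add: vec_eq_iff forall_2 matrix_matrix_mult_def sum_2)

lemma mat2_vector_mult [simp]:
  fixes a :: "'b::comm_ring_1"
  shows "mat2 a b c d *v vector [x, y] = vector [a * x + b * y, c * x + d * y]"
  by (simp add: vec_eq_iff forall_2 matrix_vector_mult_def sum_2)

lemma mat_1_eq_mat2: "(mat 1 :: 'b::comm_ring_1^2^2) = mat2 1 0 0 1"
  by (simp add: vec_eq_iff forall_2 mat_def)

lemma mat2_in_SL2_iff:
  "mat2 a b c d \<in> SL2 R \<longleftrightarrow> a \<in> R \<and> b \<in> R \<and> c \<in> R \<and> d \<in> R \<and> a * d - b * c = 1"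
  by (auto simp: SL2_def det_2 forall_2)

lemma SL2_cases:
  assumes "A \<in> SL2 R"
  obtains a b c d where "A = mat2 a b c d" "a \<in> R" "b \<in> R" "c \<in> R" "d \<in> R" "a * d - b * c = 1"
  using assms mat2_eta[of A] mat2_in_SL2_iff by metis

text \<open>
  The adjugate: a polynomial formula for the inverse on \<open>SL2\<close>, valid over every coefficient ring.
\<close>

definition adj :: "'b::comm_ring_1^2^2 \<Rightarrow> 'b^2^2" where
  "adj A = mat2 (A $ 2 $ 2) (- A $ 1 $ 2) (- A $ 2 $ 1) (A $ 1 $ 1)"

lemma adj_mat2 [simp]: "adj (mat2 a b c d) = mat2 d (- b) (- c) a"
  by (simp add: adj_def)

lemma adj_in_SL2: "is_subring R \<Longrightarrow> A \<in> SL2 R \<Longrightarrow> adj A \<in> SL2 R"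
  by (erule SL2_cases) (auto simp: mat2_in_SL2_iff is_subringD algebra_simps)

lemma adj_mult: "A \<in> SL2 R \<Longrightarrow> adj A ** A = mat 1" "A \<in> SL2 R \<Longrightarrow> A ** adj A = mat 1"
  by (auto elim!: SL2_cases simp: mat_1_eq_mat2 algebra_simps)

lemma adj_mult_cancel: "A \<in> SL2 R \<Longrightarrow> adj A ** (A ** B) = B" "A \<in> SL2 R \<Longrightarrow> A ** (adj A ** B) = B"
  by (simp_all add: matrix_mul_assoc adj_mult)

lemma matrix_inv_SL2:
  assumes "A \<in> SL2 R" shows "matrix_inv A = adj A"
proof -
  have "A ** matrix_inv A = mat 1"
    unfolding matrix_inv_def using adj_mult[OF assms]
    by (rule someI2[where a = "adj A", OF conjI[rotated]]) auto
  then have "adj A ** (A ** matrix_inv A) = adj A" by simp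
  then show ?thesis by (simp add: adj_mult_cancel[OF assms])
qed

lemma SL2_mult:
  assumes "is_subring R" "A \<in> SL2 R" "B \<in> SL2 R" shows "A ** B \<in> SL2 R"
proof -
  have "\<forall>i j. (A ** B) $ i $ j \<in> R"
    using assms(2,3) by (auto elim!: SL2_cases simp: forall_2 is_subringD[OF assms(1)])
  moreover have "det (A ** B) = 1" using assms(2,3) by (simp add: SL2_def det_mul)
  ultimately show ?thesis by (simp add: SL2_def)
qed

lemma SL2_mono: "R \<subseteq> S \<Longrightarrow> SL2 R \<subseteq> SL2 S"
  by (auto simp: SL2_def)

lemma mat_1_in_SL2: "is_subring R \<Longrightarrow> mat 1 \<in> SL2 R"
  by (simp add: mat_1_eq_mat2 mat2_in_SL2_iff is_subringD)

lemma u_mat_in_G [simp]: "u_mat s \<in> G" and d_mat_in_G [simp]: "r \<noteq> 0 \<Longrightarrow> d_mat r \<in> G"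
  and a_mat_in_G [simp]: "a_mat m \<in> G"
  by (simp_all add: u_mat_def d_mat_def a_mat_def mat2_in_SL2_iff flip: power_int_add)

lemma G_mult: "A \<in> G \<Longrightarrow> B \<in> G \<Longrightarrow> A ** B \<in> G"
  by (rule SL2_mult[OF is_subring_UNIV])

lemma Gam_subset_G: "Gam \<subseteq> G"
  by (rule SL2_mono) simp

lemma u_mat_add: "u_mat s ** u_mat t = u_mat (s + t)"
  by (simp add: u_mat_def add.commute)

lemma u_mat_0 [simp]: "u_mat 0 = mat 1"
  by (simp add: u_mat_def mat_1_eq_mat2)

section \<open>Cosets, orbits and parameter stabilizers\<close>

lemma coset_eq_iff: "coset g = coset h \<longleftrightarrow> (\<exists>\<gamma>\<in>Gam. h = \<gamma> ** g)"
proof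
  assume "coset g = coset h"
  moreover have "mat 1 ** h \<in> coset h"
    unfolding coset_def by (rule imageI) (rule mat_1_in_SL2[OF is_subring_poly_ring])
  ultimately show "\<exists>\<gamma>\<in>Gam. h = \<gamma> ** g" by (auto simp: coset_def)
next
  assume "\<exists>\<gamma>\<in>Gam. h = \<gamma> ** g"
  then obtain \<gamma> where \<gamma>: "\<gamma> \<in> Gam" "h = \<gamma> ** g" by blast
  show "coset g = coset h"
  proof
    show "coset h \<subseteq> coset g"
      unfolding coset_def \<gamma>(2) using SL2_mult[OF is_subring_poly_ring _ \<gamma>(1)]
      by (auto simp: matrix_mul_assoc)
    show "coset g \<subseteq> coset h"
    proof
      fix x assume "x \<in> coset g"
      then obtain \<delta> where \<delta>: "\<delta> \<in> Gam" "x = \<delta> ** g" by (auto simp: coset_def)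
      have "x = (\<delta> ** adj \<gamma>) ** h"
        unfolding \<gamma>(2) \<delta>(2) by (simp add: matrix_mul_assoc[symmetric] adj_mult_cancel[OF \<gamma>(1)])
      moreover have "\<delta> ** adj \<gamma> \<in> Gam"
        by (intro SL2_mult adj_in_SL2 is_subring_poly_ring \<gamma> \<delta>)
      ultimately show "x \<in> coset h" unfolding coset_def by blast
    qed
  qed
qed

lemma right_act_coset: "right_act (coset g) h = coset (g ** h)"
  by (simp add: right_act_def coset_def image_image matrix_mul_assoc)

lemma coset_mult_right: "coset g = coset h \<Longrightarrow> coset (g ** k) = coset (h ** k)"
  using right_act_coset by metis

lemma U_orbit_cong: "coset g = coset h \<Longrightarrow> U_orbit g = U_orbit h"
  unfolding U_orbit_def using coset_mult_right by metis

lemma param_stab_cong: "coset g = coset h \<Longrightarrow> param_stab g = param_stab h"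
  unfolding param_stab_def using coset_mult_right by metis

text \<open>
  The orbit is thereby identified with the quotient of \<open>F\<close> by the parameter stabilizer.
\<close>

lemma coset_u_mat_eq_iff: "coset (g ** u_mat s) = coset (g ** u_mat t) \<longleftrightarrow> s - t \<in> param_stab g"
proof
  assume "coset (g ** u_mat s) = coset (g ** u_mat t)"
  from coset_mult_right[OF this, of "u_mat (- t)"] show "s - t \<in> param_stab g"
    by (simp add: param_stab_def u_mat_add matrix_mul_assoc[symmetric])
next
  assume "s - t \<in> param_stab g"
  then have "coset (g ** u_mat (s - t)) = coset g" by (simp add: param_stab_def)
  from coset_mult_right[OF this, of "u_mat t"] show "coset (g ** u_mat s) = coset (g ** u_mat t)"
    by (simp add: u_mat_add matrix_mul_assoc[symmetric])
qed

text \<open>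
  Since \<open>U\<close> is commutative, moving the base point along the orbit preserves the stabilizer.
\<close>

lemma param_stab_mult_u_mat: "param_stab (g ** u_mat t) = param_stab g"
proof -
  have "s \<in> param_stab (g ** u_mat t) \<longleftrightarrow> coset (g ** u_mat (t + s)) = coset (g ** u_mat t)" for s
    by (simp add: param_stab_def u_mat_add matrix_mul_assoc[symmetric])
  then show ?thesis by (auto simp: coset_u_mat_eq_iff)
qed

lemma param_stab_base_point: "coset g' \<in> U_orbit g \<Longrightarrow> param_stab g' = param_stab g"
  unfolding U_orbit_def by (erule rangeE, drule param_stab_cong) (simp add: param_stab_mult_u_mat)

text \<open>
  Conjugation by \<open>d(r)\<close> carries \<open>u(s)\<close> to \<open>u(r\<^sup>2 s)\<close>, and a unipotent matrix \<open>u(x)\<close> lies in \<open>Gam\<close>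
  exactly when \<open>x\<close> is a polynomial.
\<close>

lemma param_stab_d_mat:
  assumes "r \<noteq> 0" shows "param_stab (d_mat r) = {s. r\<^sup>2 * s \<in> poly_ring}"
proof -
  have "d_mat r ** u_mat s = mat2 1 (r\<^sup>2 * s) 0 1 ** d_mat r" for s
    using assms by (simp add: d_mat_def u_mat_def power2_eq_square)
  moreover have "(\<exists>\<gamma>\<in>Gam. mat2 1 (r\<^sup>2 * s) 0 1 ** d_mat r = \<gamma> ** d_mat r) \<longleftrightarrow> r\<^sup>2 * s \<in> poly_ring" for s
  proof
    assume "\<exists>\<gamma>\<in>Gam. mat2 1 (r\<^sup>2 * s) 0 1 ** d_mat r = \<gamma> ** d_mat r"
    then obtain \<gamma> where \<gamma>: "\<gamma> \<in> Gam" "mat2 1 (r\<^sup>2 * s) 0 1 ** d_mat r = \<gamma> ** d_mat r" by blast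
    have "mat2 1 (r\<^sup>2 * s) 0 1 = (mat2 1 (r\<^sup>2 * s) 0 1 ** d_mat r) ** adj (d_mat r)"
      by (simp only: matrix_mul_assoc[symmetric] adj_mult(2)[OF d_mat_in_G[OF assms]] matrix_mul_rid)
    also have "\<dots> = \<gamma>"
      by (simp only: \<gamma>(2) matrix_mul_assoc[symmetric] adj_mult(2)[OF d_mat_in_G[OF assms]] matrix_mul_rid)
    finally have "mat2 1 (r\<^sup>2 * s) 0 1 = \<gamma>" .
    then show "r\<^sup>2 * s \<in> poly_ring" using \<gamma>(1) mat2_in_SL2_iff by blast
  next
    assume "r\<^sup>2 * s \<in> poly_ring"
    then have "mat2 1 (r\<^sup>2 * s) 0 1 \<in> Gam" by (simp add: mat2_in_SL2_iff)
    then show "\<exists>\<gamma>\<in>Gam. mat2 1 (r\<^sup>2 * s) 0 1 ** d_mat r = \<gamma> ** d_mat r" by blast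
  qed
  ultimately show ?thesis
    unfolding param_stab_def by (subst eq_commute[of "coset (_ ** _)"], subst coset_eq_iff) simp
qed

section \<open>The height\<close>

lemma vertex_act_mult: "vertex_act (A ** B) v = vertex_act A (vertex_act B v)"
  by (simp add: vertex_act_def image_image matrix_vector_mul_assoc)

lemma vertex_act_mat_1 [simp]: "vertex_act (mat 1) v = v"
  by (simp add: vertex_act_def)

lemma Gam_mult_GL2:
  assumes "\<gamma> \<in> Gam" "\<delta> \<in> GL2 poly_ring" shows "\<gamma> ** \<delta> \<in> GL2 poly_ring"
proof -
  have "(\<gamma> ** \<delta>) $ i $ j \<in> poly_ring" for i j
    using assms by (auto simp: SL2_def GL2_def matrix_matrix_mult_def sum_2 poly_ring_add poly_ring_mult)
  then show ?thesis using assms by (auto simp: SL2_def GL2_def det_mul)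
qed

text \<open>
  The definite description that defines the height depends only on the orbit of the vertex under
  \<open>GL2 poly_ring\<close>, a group containing \<open>Gam\<close>; the descriptions for \<open>v\<close> and for its translate have
  equivalent bodies and denote the same number.
\<close>

lemma height_Gam_invariant:
  assumes "\<gamma> \<in> Gam" shows "height (vertex_act \<gamma> v) = height v"
proof -
  have "(\<exists>\<delta>\<in>GL2 poly_ring. vertex_act \<gamma> v = vertex_act \<delta> w) \<longleftrightarrow>
      (\<exists>\<delta>\<in>GL2 poly_ring. v = vertex_act \<delta> w)" for w
  proof
    assume "\<exists>\<delta>\<in>GL2 poly_ring. vertex_act \<gamma> v = vertex_act \<delta> w"
    then obtain \<delta> where \<delta>: "\<delta> \<in> GL2 poly_ring" "vertex_act \<gamma> v = vertex_act \<delta> w" by blast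
    have "v = vertex_act (adj \<gamma>) (vertex_act \<gamma> v)"
      by (simp add: vertex_act_mult[symmetric] adj_mult[OF assms])
    then have "v = vertex_act (adj \<gamma> ** \<delta>) w" by (simp add: \<delta>(2) vertex_act_mult)
    then show "\<exists>\<delta>\<in>GL2 poly_ring. v = vertex_act \<delta> w"
      using Gam_mult_GL2[OF adj_in_SL2[OF is_subring_poly_ring assms] \<delta>(1)] by blast
  next
    assume "\<exists>\<delta>\<in>GL2 poly_ring. v = vertex_act \<delta> w"
    then show "\<exists>\<delta>\<in>GL2 poly_ring. vertex_act \<gamma> v = vertex_act \<delta> w"
      using Gam_mult_GL2[OF assms] by (auto simp: vertex_act_mult[symmetric])
  qed
  then show ?thesis by (simp add: height_def)
qed

text \<open>
  All representatives of a coset give the same value by invariance under \<open>Gam\<close>, so the definite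
  description in \<open>height_K\<close> has exactly this solution.
\<close>

lemma height_K_coset:
  assumes "g \<in> G" shows "height_K (coset g) = height (vertex_act g (ray_vertex 0))"
  unfolding height_K_def
proof (rule the_equality)
  show "\<exists>h\<in>G. coset g = coset h \<and> height (vertex_act g (ray_vertex 0)) = height (vertex_act h (ray_vertex 0))"
    using assms by blast
next
  fix n assume "\<exists>h\<in>G. coset g = coset h \<and> n = height (vertex_act h (ray_vertex 0))"
  then show "n = height (vertex_act g (ray_vertex 0))"
    by (auto simp: coset_eq_iff vertex_act_mult height_Gam_invariant)
qed

lemma K_image_lattice:
  assumes "k \<in> SL2 integers_O"
  shows "(\<lambda>x. k *v x) ` {x. \<forall>i. x $ i \<in> integers_O} = {x. \<forall>i. x $ i \<in> integers_O}"
proof -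
  have sub: "k *v x \<in> {x. \<forall>i. x $ i \<in> integers_O}"
    if "k \<in> SL2 integers_O" "x \<in> {x. \<forall>i. x $ i \<in> integers_O}" for k x
    using that unfolding SL2_def matrix_vector_mult_def sum_2
    by (auto intro!: is_subringD[OF is_subring_integers_O])
  have "x = k *v (adj k *v x)" for x
    by (simp add: matrix_vector_mul_assoc adj_mult[OF assms])
  with sub[OF assms] sub[OF adj_in_SL2[OF is_subring_integers_O assms]] show ?thesis by blast
qed

lemma vertex_act_K:
  assumes "k \<in> SL2 integers_O" shows "vertex_act k (ray_vertex 0) = ray_vertex 0"
proof -
  let ?L = "{x :: 'a fls^2. \<forall>i. x $ i \<in> integers_O}"
  have ray: "ray_vertex 0 = homothety_class ?L"
    by (simp add: ray_vertex_def mat_1_eq_mat2[symmetric])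
  have "(\<lambda>x. k *v x) ` (\<lambda>v. c *s v) ` ?L = (\<lambda>v. c *s v) ` (\<lambda>x. k *v x) ` ?L" for c
    by (simp add: image_image vector_scalar_commute)
  then have "(\<lambda>x. k *v x) ` (\<lambda>v. c *s v) ` ?L = (\<lambda>v. c *s v) ` ?L" for c
    by (simp add: K_image_lattice[OF assms])
  then have "vertex_act k (homothety_class ?L) = homothety_class ?L"
    unfolding vertex_act_def homothety_class_def setcompr_eq_image image_image by simp
  then show ?thesis by (simp add: ray)
qed

lemma SL2_integers_O_subset_G: "SL2 integers_O \<subseteq> G"
  by (rule SL2_mono) simp

text \<open>
  \<open>K\<close> fixes the base vertex, because it preserves the standard lattice.  This invariance makes the
  height locally constant, and it makes the height along an orbit invariant under translation by \<open>O\<close>.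
\<close>

lemma height_K_mult_K:
  assumes "g \<in> G" "k \<in> SL2 integers_O" shows "height_K (coset (g ** k)) = height_K (coset g)"
proof -
  have "g ** k \<in> G" using assms SL2_integers_O_subset_G by (auto intro: G_mult)
  then show ?thesis by (simp add: height_K_coset assms vertex_act_mult vertex_act_K)
qed

section \<open>The topology of the quotient space\<close>

lemma common_frac_ideal:
  fixes A :: "'a::field fls^2^2"
  obtains n where "\<And>i j. A $ i $ j \<in> frac_ideal n"
proof -
  define n where "n = Min (range (\<lambda>(i, j). fls_subdegree (A $ i $ j)))"
  have "n \<le> fls_subdegree (A $ i $ j)" for i j
    unfolding n_def by (rule Min_le) (auto intro!: image_eqI[of _ _ "(i, j)"])
  then show ?thesis by (intro that[of n]) (simp add: frac_ideal_iff)
qed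

lemma openin_G_entrywise:
  assumes "S \<subseteq> G"
    "\<And>g. g \<in> S \<Longrightarrow> \<exists>n. \<forall>h\<in>G. (\<forall>i j. h $ i $ j - g $ i $ j \<in> frac_ideal n) \<longrightarrow> h \<in> S"
  shows "openin (top_of_set G) (S :: ('a::field fls^2^2) set)"
proof -
  have "\<exists>T. openin (top_of_set G) T \<and> g \<in> T \<and> T \<subseteq> S" if g: "g \<in> S" for g
  proof -
    obtain n where n: "\<And>h. h \<in> G \<Longrightarrow> \<forall>i j. h $ i $ j - g $ i $ j \<in> frac_ideal n \<Longrightarrow> h \<in> S"
      using assms(2)[OF g] by blast
    define T where "T = (\<Inter>i. \<Inter>j. {h :: 'a fls^2^2. h $ i $ j - g $ i $ j \<in> frac_ideal n})"
    have "{h :: 'a fls^2^2. h $ i $ j - g $ i $ j \<in> frac_ideal n} =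
        (\<lambda>h. h $ i) -` ((\<lambda>h. h $ j) -` {y. y - g $ i $ j \<in> frac_ideal n})" for i j by auto
    then have "open T" unfolding T_def
      by (intro open_INT ballI finite_class.finite_UNIV)
         (simp only: open_vimage_vec_nth open_translate_frac_ideal)
    moreover have "g \<in> T" by (simp add: T_def)
    moreover have "G \<inter> T \<subseteq> S" using n by (auto simp: T_def)
    ultimately show ?thesis using g assms(1)
      by (intro exI[of _ "G \<inter> T"]) (auto simp: openin_open)
  qed
  then show ?thesis using openin_subopen by blast
qed

text \<open>
  The inverse of \<open>g\<close> times \<open>h\<close> is \<open>1\<close> plus the inverse of \<open>g\<close> times \<open>h - g\<close>, which is integral as soon
  as \<open>h - g\<close> is small compared with the entries of \<open>g\<close>.  In other words, \<open>g K\<close> is a neighbourhood of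
  \<open>g\<close>.
\<close>

lemma mult_K_neighbourhood:
  fixes g :: "'a::field fls^2^2"
  assumes "g \<in> G"
  obtains n where "\<And>h. h \<in> G \<Longrightarrow> \<forall>i j. h $ i $ j - g $ i $ j \<in> frac_ideal n \<Longrightarrow>
    \<exists>k\<in>SL2 integers_O. h = g ** k"
proof -
  obtain n where n: "\<And>i j. g $ i $ j \<in> frac_ideal n" using common_frac_ideal by blast
  obtain a b c d where g: "g = mat2 a b c d" "a * d - b * c = 1"
    using assms by (blast elim: SL2_cases)
  have f: "a \<in> frac_ideal n" "b \<in> frac_ideal n" "c \<in> frac_ideal n" "d \<in> frac_ideal n"
    using n[of 1 1] n[of 1 2] n[of 2 1] n[of 2 2] by (simp_all add: g(1))
  have m: "x * y \<in> frac_ideal 0" if "x \<in> frac_ideal n" "y \<in> frac_ideal (- n)" for x y :: "'a fls"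
    using frac_ideal_mult[OF that] by simp
  have "\<exists>k\<in>SL2 integers_O. h = g ** k"
    if h: "h \<in> G" "\<forall>i j. h $ i $ j - g $ i $ j \<in> frac_ideal (- n)" for h
  proof -
    obtain a' b' c' d' where h': "h = mat2 a' b' c' d'" "a' * d' - b' * c' = 1"
      using h(1) by (blast elim: SL2_cases)
    have e: "a' - a \<in> frac_ideal (- n)" "b' - b \<in> frac_ideal (- n)"
      "c' - c \<in> frac_ideal (- n)" "d' - d \<in> frac_ideal (- n)"
      using h(2)[rule_format, of 1 1] h(2)[rule_format, of 1 2]
        h(2)[rule_format, of 2 1] h(2)[rule_format, of 2 2] by (simp_all add: h'(1) g(1))
    have k: "adj g ** h \<in> G"
      using assms h(1) by (intro G_mult adj_in_SL2[OF is_subring_UNIV]) auto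
    have "adj g ** h = mat2 (1 + (d * (a' - a) - b * (c' - c))) (d * (b' - b) - b * (d' - d))
         (a * (c' - c) - c * (a' - a)) (1 + (a * (d' - d) - c * (b' - b)))"
      by (simp add: g(1) h'(1), intro conjI) (use g(2) in algebra)+
    then have "adj g ** h \<in> SL2 integers_O"
      using k e f by (simp add: mat2_in_SL2_iff integers_O_eq frac_ideal_add frac_ideal_diff m)
    then show ?thesis using adj_mult_cancel(2)[OF assms] by metis
  qed
  then show ?thesis using that by blast
qed

text \<open>
  The right translation by \<open>w\<close> is needed because the averaging argument uses level sets of the height
  moved by elements of \<open>U\<close>, and these are no longer invariant under \<open>K\<close> itself.
\<close>

lemma openin_G_K_invariant:
  fixes S :: "('a::field fls^2^2) set"
  assumes "w \<in> G" "\<And>g k. g \<in> S \<Longrightarrow> k \<in> SL2 integers_O \<Longrightarrow> g ** k \<in> S"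
  shows "openin (top_of_set G) {g \<in> G. g ** w \<in> S}"
proof (rule openin_G_entrywise)
  fix g assume "g \<in> {g \<in> G. g ** w \<in> S}"
  then have g: "g \<in> G" "g ** w \<in> S" by auto
  obtain n where n: "\<And>h. h \<in> G \<Longrightarrow> \<forall>i j. h $ i $ j - (g ** w) $ i $ j \<in> frac_ideal n \<Longrightarrow>
      \<exists>k\<in>SL2 integers_O. h = (g ** w) ** k"
    using mult_K_neighbourhood[OF G_mult[OF g(1) assms(1)]] by blast
  obtain l where l: "\<And>i j. w $ i $ j \<in> frac_ideal l" using common_frac_ideal by blast
  have "h ** w \<in> S" if h: "h \<in> G" "\<forall>i j. h $ i $ j - g $ i $ j \<in> frac_ideal (n - l)" for h
  proof -
    have "(h ** w) $ i $ j - (g ** w) $ i $ j =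
        (h $ i $ 1 - g $ i $ 1) * w $ 1 $ j + (h $ i $ 2 - g $ i $ 2) * w $ 2 $ j" for i j
      by (simp add: matrix_matrix_mult_def sum_2 algebra_simps)
    moreover have "(h $ i $ k - g $ i $ k) * w $ k $ j \<in> frac_ideal n" for i j k
      using frac_ideal_mult[OF h(2)[rule_format, of i k] l[of k j]] by simp
    ultimately have "\<forall>i j. (h ** w) $ i $ j - (g ** w) $ i $ j \<in> frac_ideal n"
      by (simp add: frac_ideal_add)
    from n[OF G_mult[OF h(1) assms(1)] this] show ?thesis using assms(2)[OF g(2)] by auto
  qed
  then show "\<exists>n. \<forall>h\<in>G. (\<forall>i j. h $ i $ j - g $ i $ j \<in> frac_ideal n) \<longrightarrow> h \<in> {g \<in> G. g ** w \<in> S}"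
    by blast
qed auto

lemma openin_X_top:
  fixes V :: "('a::field fls^2^2) set set"
  shows "openin X_top V \<longleftrightarrow> V \<subseteq> coset ` G \<and> openin (top_of_set G) {g \<in> G. coset g \<in> V}"
proof -
  have "istopology (\<lambda>V :: ('a fls^2^2) set set. V \<subseteq> coset ` G \<and> openin (top_of_set G) {g \<in> G. coset g \<in> V})"
    unfolding istopology_def
  proof (intro conjI allI impI)
    fix V W :: "('a fls^2^2) set set" assume VW: "V \<subseteq> coset ` G \<and> openin (top_of_set G) {g \<in> G. coset g \<in> V}"
      "W \<subseteq> coset ` G \<and> openin (top_of_set G) {g \<in> G. coset g \<in> W}"
    have "{g \<in> G. coset g \<in> V \<inter> W} = {g \<in> G. coset g \<in> V} \<inter> {g \<in> G. coset g \<in> W}" by auto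
    then show "openin (top_of_set G) {g \<in> G. coset g \<in> V \<inter> W}" using VW by (simp add: openin_Int)
    show "V \<inter> W \<subseteq> coset ` G" using VW by auto
  next
    fix K :: "('a fls^2^2) set set set" assume K: "\<forall>V\<in>K. V \<subseteq> coset ` G \<and> openin (top_of_set G) {g \<in> G. coset g \<in> V}"
    have "{g \<in> G. coset g \<in> \<Union>K} = (\<Union>V\<in>K. {g \<in> G. coset g \<in> V})" by auto
    then show "openin (top_of_set G) {g \<in> G. coset g \<in> \<Union>K}" using K by auto
    show "\<Union>K \<subseteq> coset ` G" using K by auto
  qed
  then show ?thesis unfolding X_top_def by (simp add: topology_inverse')
qed

lemma topspace_X_top: "topspace X_top = coset ` (G :: ('a::field fls^2^2) set)"
proof -
  have "{g \<in> G. coset g \<in> coset ` G} = (G :: ('a fls^2^2) set)" by auto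
  then have "openin X_top (coset ` (G :: ('a fls^2^2) set))"
    unfolding openin_X_top by (simp add: openin_subtopology_self)
  then have "coset ` G \<subseteq> topspace (X_top :: ('a fls^2^2) set topology)" by (rule openin_subset)
  moreover have "topspace X_top \<subseteq> coset ` (G :: ('a fls^2^2) set)"
    using openin_topspace[of "X_top :: ('a fls^2^2) set topology"] by (simp only: openin_X_top)
  ultimately show ?thesis by blast
qed

lemma openin_X_top_K_invariant:
  assumes "w \<in> G" "\<And>g k. g \<in> G \<Longrightarrow> k \<in> SL2 integers_O \<Longrightarrow> P (coset g) \<Longrightarrow> P (coset (g ** k))"
  shows "openin X_top {x \<in> coset ` G. P (right_act x w)}"
proof -
  have "openin (top_of_set G) {g \<in> G. g ** w \<in> {g \<in> G. P (coset g)}}"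
  proof (rule openin_G_K_invariant[OF assms(1)])
    fix g k :: "'a fls^2^2" assume g: "g \<in> {g \<in> G. P (coset g)}" and k: "k \<in> SL2 integers_O"
    then have "g ** k \<in> G" using SL2_integers_O_subset_G by (auto intro: G_mult)
    then show "g ** k \<in> {g \<in> G. P (coset g)}" using g k assms(2)[of g k] by auto
  qed
  moreover have "{g \<in> G. coset g \<in> {x \<in> coset ` G. P (right_act x w)}} =
      {g \<in> G. g ** w \<in> {g \<in> G. P (coset g)}}"
    using assms(1) by (auto simp: right_act_coset G_mult)
  ultimately show ?thesis unfolding openin_X_top by auto
qed

lemma continuous_orbit_map:
  assumes "g \<in> G"
  shows "continuous_map euclidean X_top (\<lambda>s. coset (g ** u_mat s))"
proof -
  have 1: "continuous_map (top_of_set G) X_top coset"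
    by (auto simp: continuous_map_def topspace_X_top openin_X_top)
  have 2: "continuous_map euclidean (top_of_set G) (\<lambda>s. g ** u_mat s)"
  proof (intro continuous_map_into_subtopology)
    obtain a b c d where g: "g = mat2 a b c d" by (rule that[OF mat2_eta])
    have "g ** u_mat s = (\<chi> i j. (if i = 1 then (if j = 1 then 0 else a) else (if j = 1 then 0 else c)) * s + g $ i $ j)" for s
      by (simp add: g u_mat_def vec_eq_iff forall_2)
    then have eq: "(\<lambda>s. g ** u_mat s) = (\<lambda>s. \<chi> i j. (if i = 1 then (if j = 1 then 0 else a) else (if j = 1 then 0 else c)) * s + g $ i $ j)"
      by (rule ext)
    show "continuous_map euclidean euclidean (\<lambda>s. g ** u_mat s)"
      unfolding eq continuous_map_iff_continuous2
      by (intro continuous_on_vec_lambda continuous_on_fls_affine)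
    show "(\<lambda>s. g ** u_mat s) \<in> topspace euclidean \<rightarrow> G" using assms by (auto intro: G_mult)
  qed
  show ?thesis using continuous_map_compose[OF 2 1] by (simp add: o_def)
qed

section \<open>Rational directions and triangular representatives\<close>

lemma fls_subdegree_poly_ring:
  assumes "x \<in> poly_ring" shows "fls_subdegree x \<le> 0"
proof (cases "x = 0")
  case False
  then have "fls_nth x (fls_subdegree x) \<noteq> 0" by simp
  then show ?thesis using assms by (metis poly_ring_iff not_le)
qed simp

text \<open>
  The Euclidean algorithm, run on column vectors: the induction is on the degree of the second entry
  (shifted by one, to separate a nonzero constant from zero).
\<close>

lemma SL2_poly_euclid:
  assumes "a \<in> poly_ring" "b \<in> poly_ring"
  obtains \<gamma> c where "\<gamma> \<in> Gam" "\<gamma> *v vector [c, 0] = vector [a, b]"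
proof -
  have "\<exists>\<gamma>\<in>Gam. \<exists>c. \<gamma> *v vector [c, 0] = vector [a, b]"
    using assms
  proof (induction "if b = 0 then 0 else nat (- fls_subdegree b) + 1" arbitrary: a b rule: less_induct)
    case less
    show ?case
    proof (cases "b = 0")
      case True
      then have "mat 1 *v vector [a, 0] = vector [a, b]" by simp
      then show ?thesis using mat_1_in_SL2[OF is_subring_poly_ring] by blast
    next
      case False
      \<comment> \<open>The remainder of \<open>a\<close> modulo \<open>b\<close> is \<open>f * b\<close>, of strictly smaller degree since \<open>f\<close> has positive
        valuation.\<close>
      obtain q f where qf: "q \<in> poly_ring" "f \<in> frac_ideal 1" "a / b = q + f"
        by (rule poly_ring_plus_frac_ideal_1)
      have r: "a - q * b = f * b" using qf(3) False by (simp add: field_simps)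
      have rP: "f * b \<in> poly_ring" unfolding r[symmetric]
        by (intro poly_ring_diff poly_ring_mult less.prems qf)
      have "fls_subdegree b \<le> 0" "fls_subdegree (f * b) \<le> 0"
        using less.prems(2) rP by (auto intro: fls_subdegree_poly_ring simp del: fls_subdegree_mult)
      moreover have "fls_subdegree (f * b) \<ge> 1 + fls_subdegree b" if "f * b \<noteq> 0"
        using that qf(2) by (auto simp: frac_ideal_iff)
      ultimately have "(if - (f * b) = 0 then 0 else nat (- fls_subdegree (- (f * b))) + 1)
          < (if b = 0 then 0 else nat (- fls_subdegree b) + 1)"
        using False by (cases "f * b = 0") (auto simp del: fls_subdegree_mult mult_eq_0_iff)
      from less.hyps[OF this less.prems(2)] rP
      obtain \<gamma> c where \<gamma>: "\<gamma> \<in> Gam" "\<gamma> *v vector [c, 0] = vector [b, - (f * b)]"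
        by auto
      have "mat2 q (- 1) 1 0 ** \<gamma> \<in> Gam"
        by (intro SL2_mult is_subring_poly_ring \<gamma>(1)) (simp add: mat2_in_SL2_iff qf(1))
      moreover have "(mat2 q (- 1) 1 0 ** \<gamma>) *v vector [c, 0] = vector [a, b]"
        using r by (simp add: matrix_vector_mul_assoc[symmetric] \<gamma>(2) algebra_simps del: mat2_mult)
      ultimately show ?thesis by blast
    qed
  qed
  then show ?thesis using that by blast
qed

lemma proj_act_proj_point: "proj_act g (proj_point v) = proj_point (g *v v)"
  by (simp add: proj_act_def proj_point_def setcompr_eq_image image_image vector_scalar_commute)

lemma proj_point_scale:
  assumes "k \<noteq> 0" shows "proj_point (k *s v) = proj_point v"
proof -
  have "(\<lambda>c. c * k) ` {c. c \<noteq> 0} = {c. c \<noteq> 0}"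
    using assms by (auto intro!: image_eqI[of c _ "c / k" for c])
  moreover have "proj_point (k *s v) = (\<lambda>c. c *s v) ` (\<lambda>c. c * k) ` {c. c \<noteq> 0}"
    by (simp add: proj_point_def setcompr_eq_image image_image)
  ultimately show ?thesis by (simp add: proj_point_def setcompr_eq_image)
qed

lemma d_u_mat: "d_mat r ** u_mat s = mat2 r (r * s) 0 (inverse r)"
  by (simp add: d_mat_def u_mat_def)

text \<open>
  Clearing denominators makes the direction \<open>g \<infinity>\<close> that of a polynomial vector; the Euclidean algorithm
  moves it to \<open>\<infinity>\<close>, and a matrix of determinant one that fixes \<open>\<infinity>\<close> is of the form \<open>d(r) u(s\<^sub>0)\<close>.
\<close>

lemma rational_decomposition:
  assumes "g \<in> G" "proj_act g proj_infty \<in> proj_line rat_field"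
  obtains \<gamma> r s\<^sub>0 where "\<gamma> \<in> Gam" "r \<noteq> 0" "adj \<gamma> ** g = d_mat r ** u_mat s\<^sub>0"
proof -
  from assms(2) obtain v where v: "proj_point (g *v vector [1, 0]) = proj_point v"
    "v \<noteq> 0" "\<forall>i. v $ i \<in> rat_field"
    by (auto simp: proj_line_def proj_infty_def proj_act_proj_point)
  have "g *v vector [1, 0] \<in> proj_point (g *v vector [1, 0])"
    unfolding proj_point_def by (auto intro!: exI[of _ 1])
  then obtain k where k: "g *v vector [1, 0] = k *s v"
    unfolding v(1) by (auto simp: proj_point_def)
  have "v $ 1 \<in> rat_field" "v $ 2 \<in> rat_field" using v(3) by blast+
  then obtain p1 q1 p2 q2 where pq: "v $ 1 = p1 / q1" "v $ 2 = p2 / q2"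
    "p1 \<in> poly_ring" "p2 \<in> poly_ring" "q1 \<in> poly_ring" "q2 \<in> poly_ring" "q1 \<noteq> 0" "q2 \<noteq> 0"
    by (auto simp: rat_field_def)
  obtain \<gamma> c where \<gamma>: "\<gamma> \<in> Gam" "\<gamma> *v vector [c, 0] = vector [p1 * q2, p2 * q1]"
    by (rule SL2_poly_euclid[OF poly_ring_mult[OF pq(3,6)] poly_ring_mult[OF pq(4,5)]])
  have "v = inverse (q1 * q2) *s (\<gamma> *v vector [c, 0])"
    unfolding \<gamma>(2) using pq by (simp add: vec_eq_iff forall_2 field_simps)
  then have "g *v vector [1, 0] = (k * inverse (q1 * q2)) *s (\<gamma> *v vector [c, 0])"
    unfolding k by (simp add: vector_smult_assoc)
  then have col: "(adj \<gamma> ** g) *v vector [1, 0] = (k * inverse (q1 * q2)) *s vector [c, 0]"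
    by (simp add: matrix_vector_mul_assoc[symmetric] vector_scalar_commute)
       (simp add: matrix_vector_mul_assoc adj_mult[OF \<gamma>(1)])
  have "adj \<gamma> ** g \<in> G"
    using adj_in_SL2[OF is_subring_poly_ring \<gamma>(1)] Gam_subset_G assms(1) by (intro G_mult) auto
  then obtain r x y z where h: "adj \<gamma> ** g = mat2 r x y z" "r * z - x * y = 1"
    by (blast elim: SL2_cases)
  have "y = 0" using col unfolding h by (simp add: vec_eq_iff forall_2)
  with h(2) have "r * z = 1" by simp
  then have "r \<noteq> 0" "z = inverse r" by (auto simp: inverse_unique)
  with \<open>y = 0\<close> have "adj \<gamma> ** g = d_mat r ** u_mat (x / r)"
    by (simp add: h(1) d_u_mat)
  with \<open>r \<noteq> 0\<close> \<gamma>(1) that show ?thesis by blast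
qed

lemma poly_ring_subset_rat_field: "poly_ring \<subseteq> rat_field"
proof
  fix x :: "'a fls" assume "x \<in> poly_ring"
  moreover have "x = x / 1" by simp
  ultimately show "x \<in> rat_field" unfolding rat_field_def using poly_ring_1 one_neq_zero by blast
qed

lemma rational_if_dependent:
  assumes "mat2 a b c d \<in> G" "p \<in> poly_ring" "q \<in> poly_ring" "p \<noteq> 0 \<or> q \<noteq> 0" "p * a + q * c = 0"
  shows "proj_act (mat2 a b c d) proj_infty \<in> proj_line rat_field"
proof -
  have nz: "a \<noteq> 0 \<or> c \<noteq> 0" using assms(1) by (auto simp: mat2_in_SL2_iff)
  obtain k where k: "k \<noteq> 0" "vector [a, c] = k *s (vector [q, - p] :: 'a fls^2)"
  proof (cases "q = 0")
    case True
    then have "a = 0" "p \<noteq> 0" "c \<noteq> 0" using assms(4,5) nz by auto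
    with True show ?thesis by (intro that[of "- c / p"]) (auto simp: vec_eq_iff forall_2)
  next
    case False
    then have c: "c = - (p * a) / q" using assms(5) by (simp add: field_simps eq_neg_iff_add_eq_0)
    with nz have "a \<noteq> 0" by auto
    with False c show ?thesis by (intro that[of "a / q"]) (auto simp: vec_eq_iff forall_2)
  qed
  have "proj_act (mat2 a b c d) proj_infty = proj_point (vector [q, - p])"
    by (simp add: proj_infty_def proj_act_proj_point k(2) proj_point_scale[OF k(1)])
  moreover have "(vector [q, - p] :: 'a fls^2) \<noteq> 0" using assms(4) by (auto simp: vec_eq_iff forall_2)
  moreover have "\<forall>i. (vector [q, - p] :: 'a fls^2) $ i \<in> rat_field"
    using assms(2,3) poly_ring_subset_rat_field by (auto simp: forall_2)
  ultimately show ?thesis unfolding proj_line_def by blast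
qed

section \<open>Compact orbits have rational directions\<close>

text \<open>
  Dirichlet's theorem for Laurent series.  The fractional parts of the infinitely many series
  \<open>t\<^sup>n x\<close> take only finitely many values modulo \<open>frac_ideal N\<close>, so two of them agree; their difference
  gives \<open>p\<close> and \<open>q\<close>.
\<close>

lemma poly_ring_approximation:
  fixes x :: "'a::{field,finite} fls"
  obtains p q where "p \<in> poly_ring" "q \<in> poly_ring" "p \<noteq> 0" "p * x + q \<in> frac_ideal N"
proof -
  have "\<exists>f. f \<in> frac_ideal 1 \<and> tvar ^ n * x - f \<in> poly_ring" for n
    using poly_ring_plus_frac_ideal_1[of "tvar ^ n * x"] by (metis add_diff_cancel_right')
  then obtain f where f: "\<And>n. f n \<in> frac_ideal 1" "\<And>n. tvar ^ n * x - f n \<in> poly_ring" by metis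
  \<comment> \<open>The class of the fractional part modulo \<open>frac_ideal N\<close>, recorded by finitely many coefficients.\<close>
  define w where "w n = (\<lambda>k. if k \<in> {1..<N} then fls_nth (f n) k else 0)" for n
  have "finite {h. \<forall>k. (k \<in> {1..<N} \<longrightarrow> h k \<in> (UNIV :: 'a set)) \<and> (k \<notin> {1..<N} \<longrightarrow> h k = 0)}"
    by (rule finite_set_of_finite_funs) auto
  then have "finite (range w)"
    by (rule finite_subset[rotated]) (auto simp: w_def)
  then have "\<not> inj w" using finite_imageD infinite_UNIV_nat by blast
  then obtain i j where ij: "i \<noteq> j" "w i = w j" by (auto simp: inj_def)
  have "fls_nth (f i) k = fls_nth (f j) k" if "k < N" for k
    using fun_cong[OF ij(2), of k] f(1)[of i] f(1)[of j] that
    by (auto simp: w_def frac_ideal_def split: if_splits)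
  then have "f i - f j \<in> frac_ideal N" by (simp add: frac_ideal_def)
  moreover have "(tvar ^ i - tvar ^ j) * x + ((tvar ^ j * x - f j) - (tvar ^ i * x - f i)) = f i - f j"
    by (simp add: algebra_simps)
  moreover have "tvar ^ i - tvar ^ j \<noteq> (0 :: 'a fls)"
  proof
    assume "tvar ^ i - tvar ^ j = (0 :: 'a fls)"
    then have "fls_subdegree (tvar ^ i :: 'a fls) = fls_subdegree (tvar ^ j :: 'a fls)" by simp
    with ij(1) show False by simp
  qed
  ultimately show ?thesis
    using f(2)
    by (intro that[of "tvar ^ i - tvar ^ j" "(tvar ^ j * x - f j) - (tvar ^ i * x - f i)"])
      (simp_all only: poly_ring_diff tvar_power_in_poly_ring not_False_eq_True)
qed

text \<open>
  The lattice attached to \<open>g\<close> consists of the row vectors \<open>(p, q) g\<close> with polynomial \<open>p\<close> and \<open>q\<close>; a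
  vector is short when both its entries have large valuation.
\<close>

definition has_short_vector :: "int \<Rightarrow> 'a::field fls^2^2 \<Rightarrow> bool" where
  "has_short_vector N g \<longleftrightarrow> (\<exists>p\<in>poly_ring. \<exists>q\<in>poly_ring. (p \<noteq> 0 \<or> q \<noteq> 0) \<and>
     (\<forall>j. p * g $ 1 $ j + q * g $ 2 $ j \<in> frac_ideal N))"

lemma has_short_vector_Gam:
  assumes "\<gamma> \<in> Gam" "has_short_vector N (\<gamma> ** g)" shows "has_short_vector N g"
proof -
  obtain a b c d where \<gamma>: "\<gamma> = mat2 a b c d" "a \<in> poly_ring" "b \<in> poly_ring" "c \<in> poly_ring"
    "d \<in> poly_ring" "a * d - b * c = 1" using assms(1) by (blast elim: SL2_cases)
  obtain p q where pq: "p \<in> poly_ring" "q \<in> poly_ring" "p \<noteq> 0 \<or> q \<noteq> 0"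
    "\<And>j. p * (\<gamma> ** g) $ 1 $ j + q * (\<gamma> ** g) $ 2 $ j \<in> frac_ideal N"
    using assms(2) unfolding has_short_vector_def by blast
  have "p * (\<gamma> ** g) $ 1 $ j + q * (\<gamma> ** g) $ 2 $ j =
      (p * a + q * c) * g $ 1 $ j + (p * b + q * d) * g $ 2 $ j" for j
    by (simp add: matrix_matrix_mult_def sum_2 \<gamma>(1) algebra_simps)
  moreover have "p * a + q * c \<noteq> 0 \<or> p * b + q * d \<noteq> 0"
  proof -
    have "p = d * (p * a + q * c) - c * (p * b + q * d)" "q = a * (p * b + q * d) - b * (p * a + q * c)"
      using \<gamma>(6) by algebra+
    with pq(3) show ?thesis by (metis mult_zero_right diff_zero)
  qed
  moreover have "p * a + q * c \<in> poly_ring" "p * b + q * d \<in> poly_ring"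
    using \<gamma> pq by (auto intro: poly_ring_add poly_ring_mult)
  ultimately show ?thesis using pq(4) unfolding has_short_vector_def by metis
qed

lemma has_short_vector_K:
  assumes "k \<in> SL2 integers_O" "has_short_vector N g" shows "has_short_vector N (g ** k)"
proof -
  obtain p q where pq: "p \<in> poly_ring" "q \<in> poly_ring" "p \<noteq> 0 \<or> q \<noteq> 0"
    "\<And>j. p * g $ 1 $ j + q * g $ 2 $ j \<in> frac_ideal N"
    using assms(2) unfolding has_short_vector_def by blast
  have "p * (g ** k) $ 1 $ j + q * (g ** k) $ 2 $ j =
      (p * g $ 1 $ 1 + q * g $ 2 $ 1) * k $ 1 $ j + (p * g $ 1 $ 2 + q * g $ 2 $ 2) * k $ 2 $ j" for j
    by (simp add: matrix_matrix_mult_def sum_2 algebra_simps)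
  moreover have "x * k $ i $ j \<in> frac_ideal N" if "x \<in> frac_ideal N" for x i j
    using frac_ideal_mult[OF that, of "k $ i $ j" 0] assms(1) by (simp add: SL2_def integers_O_eq)
  ultimately have "p * (g ** k) $ 1 $ j + q * (g ** k) $ 2 $ j \<in> frac_ideal N" for j
    using pq(4) by (simp add: frac_ideal_add)
  with pq(1-3) show ?thesis unfolding has_short_vector_def by blast
qed

lemma has_short_vector_antimono: "M \<le> N \<Longrightarrow> has_short_vector N g \<Longrightarrow> has_short_vector M g"
  unfolding has_short_vector_def using frac_ideal_antimono[of M N] by blast

text \<open>
  Lattices are discrete: \<open>(p, q)\<close> is recovered from \<open>(p, q) g\<close> by the inverse of \<open>g\<close>, so a very short
  vector would come from polynomials of positive valuation, that is, from zero.
\<close>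

lemma no_very_short_vector:
  assumes "g \<in> G" obtains N :: nat where "\<not> has_short_vector (int N) g"
proof -
  obtain a b c d where g: "g = mat2 a b c d" "a * d - b * c = 1"
    using assms by (blast elim: SL2_cases)
  obtain n where n: "\<And>i j. g $ i $ j \<in> frac_ideal n" using common_frac_ideal by blast
  define N where "N = nat (1 - n)"
  have "\<not> has_short_vector (int N) g"
  proof
    assume "has_short_vector (int N) g"
    then have "has_short_vector (1 - n) g" by (rule has_short_vector_antimono[rotated]) (simp add: N_def)
    then obtain p q where pq: "p \<in> poly_ring" "q \<in> poly_ring" "p \<noteq> 0 \<or> q \<noteq> 0"
      "\<And>j. p * g $ 1 $ j + q * g $ 2 $ j \<in> frac_ideal (1 - n)"
      unfolding has_short_vector_def by blast
    have e: "p * a + q * c \<in> frac_ideal (1 - n)" "p * b + q * d \<in> frac_ideal (1 - n)"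
      using pq(4)[of 1] pq(4)[of 2] by (simp_all add: g(1))
    have f: "a \<in> frac_ideal n" "b \<in> frac_ideal n" "c \<in> frac_ideal n" "d \<in> frac_ideal n"
      using n[of 1 1] n[of 1 2] n[of 2 1] n[of 2 2] by (simp_all add: g(1))
    have m: "x * y \<in> frac_ideal 1" if "x \<in> frac_ideal n" "y \<in> frac_ideal (1 - n)" for x y :: "'a fls"
      using frac_ideal_mult[OF that] by simp
    have "p = d * (p * a + q * c) - c * (p * b + q * d)" "q = a * (p * b + q * d) - b * (p * a + q * c)"
      using g(2) by algebra+
    then have "p \<in> frac_ideal 1" "q \<in> frac_ideal 1"
      using e f m by (metis frac_ideal_diff)+
    with pq(1-3) poly_ring_inter_frac_ideal_1 show False by blast
  qed
  then show ?thesis using that by blast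
qed

text \<open>
  Short vectors are preserved by \<open>K\<close>, so lattices without short vectors form an open set; as the bound
  on the length shrinks, these sets increase and exhaust \<open>X\<close>.  A compact orbit is contained in one of
  them.
\<close>

lemma compact_orbit_no_short_vector:
  assumes "g \<in> G" "compactin X_top (U_orbit g)"
  obtains N where "\<And>s. \<not> has_short_vector N (g ** u_mat s)"
proof -
  define V :: "nat \<Rightarrow> ('a fls^2^2) set set" where "V N = {x \<in> coset ` G. \<forall>h\<in>x. \<not> has_short_vector (int N) h}" for N :: nat
  have "openin X_top (V N)" for N
  proof -
    have "openin X_top {x \<in> coset ` G. \<forall>h\<in>right_act x (mat 1). \<not> has_short_vector (int N) (h :: 'a fls^2^2)}"
    proof (rule openin_X_top_K_invariant[OF mat_1_in_SL2[OF is_subring_UNIV]])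
      fix g k :: "'a fls^2^2"
      assume k: "k \<in> SL2 integers_O" and *: "\<forall>h\<in>coset g. \<not> has_short_vector (int N) h"
      show "\<forall>h\<in>coset (g ** k). \<not> has_short_vector (int N) h"
      proof (rule ballI, rule notI)
        fix h assume "h \<in> coset (g ** k)" "has_short_vector (int N) h"
        then obtain \<gamma> where \<gamma>: "\<gamma> \<in> Gam" "has_short_vector (int N) (\<gamma> ** (g ** k))"
          by (auto simp: coset_def)
        have "has_short_vector (int N) ((\<gamma> ** (g ** k)) ** adj k)"
          by (intro has_short_vector_K adj_in_SL2 is_subring_integers_O k \<gamma>)
        then have "has_short_vector (int N) (\<gamma> ** g)"
          by (simp only: matrix_mul_assoc[symmetric] adj_mult[OF k] matrix_mul_rid)
        moreover have "\<gamma> ** g \<in> coset g" using \<gamma>(1) by (auto simp: coset_def)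
        ultimately show False using * by blast
      qed
    qed
    then show ?thesis by (simp add: V_def right_act_def)
  qed
  moreover have "U_orbit g \<subseteq> \<Union> (range V)"
  proof
    fix x assume "x \<in> U_orbit g"
    then obtain s where x: "x = coset (g ** u_mat s)" by (auto simp: U_orbit_def)
    have h: "g ** u_mat s \<in> G" using assms(1) by (simp add: G_mult)
    then obtain N :: nat where "\<not> has_short_vector (int N) (g ** u_mat s)"
      by (rule no_very_short_vector)
    then have "\<forall>h\<in>x. \<not> has_short_vector (int N) h"
      unfolding x coset_def using has_short_vector_Gam by blast
    then have "x \<in> V N" using h unfolding V_def x by blast
    then show "x \<in> \<Union> (range V)" by blast
  qed
  ultimately obtain \<F> where \<F>: "finite \<F>" "\<F> \<subseteq> range V" "U_orbit g \<subseteq> \<Union>\<F>"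
    using compactinD[OF assms(2), of "range V"] by blast
  then obtain J where J: "finite J" "\<F> = V ` J" using finite_subset_image[of \<F> V UNIV] by blast
  define N where "N = Max (insert 0 J)"
  have "\<not> has_short_vector (int N) (g ** u_mat s)" for s
  proof
    assume sh: "has_short_vector (int N) (g ** u_mat s)"
    have "coset (g ** u_mat s) \<in> \<Union>\<F>" using \<F>(3) by (auto simp: U_orbit_def)
    then obtain M where M: "M \<in> J" "coset (g ** u_mat s) \<in> V M" using J(2) by blast
    have "M \<le> N" using M(1) J(1) by (simp add: N_def)
    then have "has_short_vector (int M) (g ** u_mat s)" using sh has_short_vector_antimono[of "int M" "int N"] by simp
    moreover have "g ** u_mat s \<in> coset (g ** u_mat s)"
      unfolding coset_def using mat_1_in_SL2[OF is_subring_poly_ring] by (intro image_eqI[of _ _ "mat 1"]) auto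
    ultimately show False using M(2) by (auto simp: V_def)
  qed
  then show ?thesis using that by blast
qed

text \<open>
  The supposed irrationality says that the first coordinates of nonzero lattice vectors never vanish,
  while approximation makes them arbitrarily small.
\<close>

lemma compact_orbit_rational:
  fixes g :: "'a::{field,finite} fls^2^2"
  assumes "g \<in> G" "compactin X_top (U_orbit g)"
  shows "proj_act g proj_infty \<in> proj_line rat_field"
proof (rule ccontr)
  assume irr: "\<not> ?thesis"
  obtain a b c d where g: "g = mat2 a b c d" using assms(1) by (blast elim: SL2_cases)
  obtain N where N: "\<And>s. \<not> has_short_vector N (g ** u_mat s)"
    using compact_orbit_no_short_vector[OF assms] by blast
  have ind: "p * a + q * c \<noteq> 0" if "p \<in> poly_ring" "q \<in> poly_ring" "p \<noteq> 0 \<or> q \<noteq> 0" for p q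
    using rational_if_dependent[of a b c d p q] irr assms(1) that unfolding g by blast
  have "c \<noteq> 0" using ind[of 0 1] by simp
  obtain p q where pq: "p \<in> poly_ring" "q \<in> poly_ring" "p \<noteq> 0"
    "p * (a / c) + q \<in> frac_ideal (N - fls_subdegree c)" by (rule poly_ring_approximation)
  have "c * (p * (a / c) + q) = p * a + q * c" using \<open>c \<noteq> 0\<close> by (simp add: field_simps)
  then have small: "p * a + q * c \<in> frac_ideal N"
    using frac_ideal_mult_iff[OF \<open>c \<noteq> 0\<close>] pq(4) by metis
  \<comment> \<open>Right multiplication by \<open>u(s)\<close> adds \<open>s\<close> times the first coordinate to the second; this \<open>s\<close> makes
    the second coordinate vanish and keeps the first one small.\<close>
  define s where "s = - (p * b + q * d) / (p * a + q * c)"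
  have "p * (a * s + b) + q * (c * s + d) = s * (p * a + q * c) + (p * b + q * d)"
    by (simp add: algebra_simps)
  also have "\<dots> = 0" using ind[of p q] pq by (simp add: s_def)
  finally have z: "p * (a * s + b) + q * (c * s + d) = 0" .
  have "\<forall>j. p * (g ** u_mat s) $ 1 $ j + q * (g ** u_mat s) $ 2 $ j \<in> frac_ideal N"
    using small z by (simp add: forall_2 g u_mat_def)
  then have "has_short_vector N (g ** u_mat s)"
    unfolding has_short_vector_def using pq by blast
  with N show False by blast
qed

section \<open>Orbits with rational directions are compact\<close>

text \<open>
  The ball is a continuous image of a product of countably many copies of the finite residue field, by
  reading a sequence as coefficients; Tychonoff's theorem applies.
\<close>

lemma compact_frac_ideal:
  "compact (frac_ideal n :: 'a::{field,finite} fls set)"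
proof -
  define \<Phi> :: "(nat \<Rightarrow> 'a) \<Rightarrow> 'a fls" where
    "\<Phi> f = fls_shift (- n) (fps_to_fls (Abs_fps f))" for f
  have nth: "fls_nth (\<Phi> f) k = (if k < n then 0 else f (nat (k - n)))" for f k
    by (simp add: \<Phi>_def)
  let ?P = "product_topology (\<lambda>_::nat. discrete_topology (UNIV :: 'a set)) UNIV"
  have cont: "continuous_map ?P euclidean \<Phi>"
    unfolding continuous_map_def
  proof (intro conjI allI impI)
    fix U :: "'a fls set" assume "openin euclidean U"
    then have U: "open U" by simp
    show "openin ?P {f \<in> topspace ?P. \<Phi> f \<in> U}"
      unfolding openin_product_topology_alt
    proof
      fix f assume "f \<in> {f \<in> topspace ?P. \<Phi> f \<in> U}"
      then obtain N where N: "\<And>y. y - \<Phi> f \<in> frac_ideal N \<Longrightarrow> y \<in> U"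
        using U unfolding open_fls_iff by blast
      \<comment> \<open>Prescribing the coefficients below degree \<open>N\<close> is a condition on finitely many coordinates.\<close>
      define W where "W i = (if n + int i < N then {f i} else UNIV)" for i
      have "h \<in> {f \<in> topspace ?P. \<Phi> f \<in> U}" if "h \<in> Pi\<^sub>E UNIV W" for h
      proof -
        have "fls_nth (\<Phi> h) k = fls_nth (\<Phi> f) k" if "k < N" for k
          using \<open>h \<in> Pi\<^sub>E UNIV W\<close> that PiE_mem[of h UNIV W "nat (k - n)"] by (auto simp: nth W_def)
        then have "\<Phi> h - \<Phi> f \<in> frac_ideal N" by (simp add: frac_ideal_def)
        then show ?thesis using N by simp
      qed
      moreover have "finite {i \<in> UNIV. W i \<noteq> topspace (discrete_topology UNIV)}"
        by (rule finite_subset[of _ "{..nat (N - n)}"]) (auto simp: W_def split: if_splits)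
      moreover have "f \<in> Pi\<^sub>E UNIV W" by (auto simp: W_def PiE_iff)
      ultimately show "\<exists>W. finite {i \<in> UNIV. W i \<noteq> topspace (discrete_topology (UNIV :: 'a set))} \<and>
         (\<forall>i\<in>UNIV. openin (discrete_topology UNIV) (W i)) \<and> f \<in> Pi\<^sub>E UNIV W \<and> Pi\<^sub>E UNIV W \<subseteq> {f \<in> topspace ?P. \<Phi> f \<in> U}"
        by (intro exI[of _ W]) auto
    qed
  qed auto
  have "compact_space ?P"
    unfolding compact_space_product_topology by (simp add: compact_space_discrete_topology)
  then have "compactin euclidean (\<Phi> ` topspace ?P)"
    using cont by (intro image_compactin[of ?P]) (auto simp: compact_space_def)
  moreover have "x \<in> \<Phi> ` topspace ?P" if "x \<in> frac_ideal n" for x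
    using that by (intro image_eqI[of _ _ "\<lambda>i. fls_nth x (n + int i)"])
      (auto simp: fls_eq_iff nth frac_ideal_def)
  then have "\<Phi> ` topspace ?P = frac_ideal n"
    by (auto simp: frac_ideal_def nth)
  ultimately show ?thesis by simp
qed

text \<open>
  The decomposition into polynomial part and fractional part, scaled by \<open>r\<^sup>-\<^sup>2\<close>.
\<close>

lemma param_stab_complement:
  assumes "r \<noteq> 0"
  shows "\<exists>!f. f \<in> frac_ideal (1 - 2 * fls_subdegree r) \<and> s - f \<in> param_stab (d_mat r)"
proof -
  have r2: "r\<^sup>2 \<noteq> 0" "fls_subdegree (r\<^sup>2) = 2 * fls_subdegree r"
    using assms by (simp_all add: power2_eq_square)
  have mem: "f \<in> frac_ideal (1 - 2 * fls_subdegree r) \<longleftrightarrow> r\<^sup>2 * f \<in> frac_ideal 1" for f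
    using frac_ideal_mult_iff[OF r2(1), of f 1] by (simp add: r2(2))
  obtain p f where pf: "p \<in> poly_ring" "f \<in> frac_ideal 1" "r\<^sup>2 * s = p + f"
    by (rule poly_ring_plus_frac_ideal_1)
  show ?thesis
  proof (rule ex1I[of _ "f / r\<^sup>2"])
    show "f / r\<^sup>2 \<in> frac_ideal (1 - 2 * fls_subdegree r) \<and> s - f / r\<^sup>2 \<in> param_stab (d_mat r)"
      using pf r2(1) by (simp add: mem param_stab_d_mat[OF assms] right_diff_distrib)
  next
    fix h assume "h \<in> frac_ideal (1 - 2 * fls_subdegree r) \<and> s - h \<in> param_stab (d_mat r)"
    then have h: "r\<^sup>2 * h \<in> frac_ideal 1" "r\<^sup>2 * (s - h) \<in> poly_ring"
      by (simp_all add: mem param_stab_d_mat[OF assms])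
    have "r\<^sup>2 * (s - h) - p = f - r\<^sup>2 * h" using pf(3) by (simp add: algebra_simps)
    then have "f - r\<^sup>2 * h = 0"
      using poly_ring_diff[OF h(2) pf(1)] frac_ideal_diff[OF pf(2) h(1)] poly_ring_inter_frac_ideal_1
      by metis
    then show "h = f / r\<^sup>2" using r2(1) by (simp add: field_simps)
  qed
qed

lemma U_orbit_mult_u_mat: "U_orbit (g ** u_mat t) = U_orbit g"
proof -
  have "U_orbit (g ** u_mat t) = (\<lambda>s. coset (g ** u_mat s)) ` range ((+) t)"
    by (simp add: U_orbit_def u_mat_add matrix_mul_assoc[symmetric] image_image del: surj_plus)
  also have "range ((+) t) = UNIV" by simp
  finally show ?thesis by (simp add: U_orbit_def)
qed

lemma compact_U_orbit_d_mat:
  fixes r :: "'a::{field,finite} fls"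
  assumes "r \<noteq> 0" shows "compactin X_top (U_orbit (d_mat r))"
proof -
  let ?I = "frac_ideal (1 - 2 * fls_subdegree r) :: 'a fls set"
  have "coset (d_mat r ** u_mat s) \<in> (\<lambda>s. coset (d_mat r ** u_mat s)) ` ?I" for s
    using param_stab_complement[OF assms, of s] by (auto simp: coset_u_mat_eq_iff image_iff)
  then have "U_orbit (d_mat r) = (\<lambda>s. coset (d_mat r ** u_mat s)) ` ?I"
    unfolding U_orbit_def by blast
  moreover have "compactin euclidean ?I" by (simp add: compact_frac_ideal)
  ultimately show ?thesis
    using image_compactin[OF _ continuous_orbit_map[OF d_mat_in_G[OF assms]]] by simp
qed

lemma adj_mult_eq_imp_coset_eq:
  assumes "\<gamma> \<in> Gam" "adj \<gamma> ** g = h" shows "coset g = coset h"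
  unfolding coset_eq_iff using assms adj_in_SL2[OF is_subring_poly_ring] by blast

section \<open>Covolumes\<close>

text \<open>
  The translation is written in affine form, ready for the continuity lemma for affine maps.
\<close>

lemma translate_eq_vimage: "(+) s ` A = (\<lambda>x. 1 * x + - s) -` (A :: 'a::field fls set)"
proof -
  have "x \<in> (+) s ` A" if "x - s \<in> A" for x
    using image_eqI[of x "(+) s" "x - s" A] that by simp
  then show ?thesis by auto
qed

lemma translate_borel:
  assumes "A \<in> sets borel" shows "(+) s ` A \<in> sets (borel :: 'a::field fls measure)"
proof -
  have "(\<lambda>x. 1 * x + - s) \<in> borel_measurable (borel :: 'a fls measure)"
    by (intro borel_measurable_continuous_onI continuous_on_fls_affine)
  from measurable_sets[OF this assms] show ?thesis by (simp add: translate_eq_vimage)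
qed

lemma card_field_ge_2: "2 \<le> CARD('a::{field,finite})"
proof -
  have "card {0::'a, 1} \<le> CARD('a)" by (intro card_mono) auto
  then show ?thesis by simp
qed

text \<open>
  A ball is the disjoint union of the translates of the next smaller ball by the possible
  values of the lowest coefficient, so consecutive measures differ by the factor \<open>q\<close>; the normalization fixes them all.
\<close>

lemma emeasure_frac_ideal:
  fixes \<mu> :: "'a::{field,finite} fls measure"
  assumes "normalized_haar \<mu>"
  shows "emeasure \<mu> (frac_ideal n) = ennreal (real CARD('a) powi (- n))"
proof -
  have sets: "sets \<mu> = sets borel" and
    inv: "\<And>s A. A \<in> sets borel \<Longrightarrow> emeasure \<mu> ((+) s ` A) = emeasure \<mu> A" and
    one: "emeasure \<mu> (frac_ideal 0) = 1"
    using assms by (auto simp: normalized_haar_def integers_O_eq)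
  have meas: "frac_ideal k \<in> sets borel" for k :: int
    by (intro borel_open open_frac_ideal)
  have q: "real CARD('a) > 0" using card_field_ge_2[where 'a = 'a] by simp
  have step: "emeasure \<mu> (frac_ideal k) = ennreal (real CARD('a)) * emeasure \<mu> (frac_ideal (k + 1))" for k
  proof -
    let ?T = "\<lambda>c. (+) (fls_shift (- k) (fls_const c)) ` frac_ideal (k + 1) :: 'a fls set"
    have T: "x \<in> ?T c \<longleftrightarrow> x \<in> frac_ideal k \<and> fls_nth x k = c" for x c
    proof -
      have "x \<in> ?T c \<longleftrightarrow> x - fls_shift (- k) (fls_const c) \<in> frac_ideal (k + 1)"
        by (auto simp: image_iff intro: bexI[of _ "x - fls_shift (- k) (fls_const c)"])
      also have "\<dots> \<longleftrightarrow> x \<in> frac_ideal k \<and> fls_nth x k = c"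
        by (auto simp: frac_ideal_def)
      finally show ?thesis .
    qed
    have "frac_ideal k = (\<Union>c\<in>UNIV. ?T c)" using T by blast
    also have "emeasure \<mu> \<dots> = (\<Sum>c\<in>UNIV. emeasure \<mu> (?T c))"
    proof (rule sum_emeasure[symmetric])
      show "range ?T \<subseteq> sets \<mu>" using translate_borel[OF meas] by (auto simp: sets)
      have "?T c \<inter> ?T c' = {}" if "c \<noteq> c'" for c c'
      proof (rule equals0I)
        fix x assume "x \<in> ?T c \<inter> ?T c'"
        then have "fls_nth x k = c" "fls_nth x k = c'" unfolding Int_iff T by blast+
        with that show False by simp
      qed
      then show "disjoint_family ?T" by (simp only: disjoint_family_on_def) simp
    qed simp
    also have "\<dots> = ennreal (real CARD('a)) * emeasure \<mu> (frac_ideal (k + 1))"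
      by (simp add: inv[OF meas] ennreal_of_nat_eq_real_of_nat)
    finally show ?thesis .
  qed
  show ?thesis
  proof (induction n rule: int_induct[of _ 0])
    case base
    then show ?case by (simp add: one)
  next
    case (step1 i)
    have "ennreal (real CARD('a)) * emeasure \<mu> (frac_ideal (i + 1)) = ennreal (real CARD('a) powi (- i))"
      using step[of i] step1 by simp
    also have "\<dots> = ennreal (real CARD('a)) * ennreal (real CARD('a) powi (- (i + 1)))"
      using q power_int_add[of "real CARD('a)" 1 "- (i + 1)"] by (simp add: ennreal_mult[symmetric])
    finally show ?case
      using q ennreal_mult_cancel_left[of "ennreal (real CARD('a))"] by simp
  next
    case (step2 i)
    have "emeasure \<mu> (frac_ideal (i - 1)) = ennreal (real CARD('a)) * ennreal (real CARD('a) powi (- i))"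
      using step[of "i - 1"] step2 by simp
    also have "\<dots> = ennreal (real CARD('a) powi (- (i - 1)))"
      using q power_int_add[of "real CARD('a)" 1 "- i"] by (simp add: ennreal_mult[symmetric])
    finally show ?case .
  qed
qed

text \<open>
  Cut each of the two domains into pieces by the translates of the other one; corresponding pieces are
  translates of each other.  Countability of \<open>\<Lambda>\<close> lets the measures be summed.
\<close>

lemma emeasure_fundamental_domain_unique:
  fixes \<mu> :: "'a::field fls measure"
  assumes "normalized_haar \<mu>" "countable \<Lambda>" "\<And>x. - x \<in> \<Lambda> \<longleftrightarrow> x \<in> \<Lambda>"
    "fundamental_domain \<Lambda> D" "fundamental_domain \<Lambda> E"
  shows "emeasure \<mu> D = emeasure \<mu> E"
proof -
  have sets: "sets \<mu> = sets borel" and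
    inv: "\<And>s A. A \<in> sets borel \<Longrightarrow> emeasure \<mu> ((+) s ` A) = emeasure \<mu> A"
    using assms by (auto simp: normalized_haar_def)
  have decomp: "emeasure \<mu> A = (\<integral>\<^sup>+l. emeasure \<mu> (A \<inter> (+) l ` B) \<partial>count_space \<Lambda>)"
    if A: "fundamental_domain \<Lambda> A" and B: "fundamental_domain \<Lambda> B" for A B
  proof -
    have "\<exists>l\<in>\<Lambda>. x \<in> (+) l ` B" for x
    proof -
      obtain d where d: "d \<in> B" "x - d \<in> \<Lambda>" using B unfolding fundamental_domain_def by blast
      then show ?thesis by (intro bexI[of _ "x - d"] image_eqI[of _ _ d]) auto
    qed
    then have "A = (\<Union>l\<in>\<Lambda>. A \<inter> (+) l ` B)" by blast
    moreover have "emeasure \<mu> (\<Union>l\<in>\<Lambda>. A \<inter> (+) l ` B) =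
        (\<integral>\<^sup>+l. emeasure \<mu> (A \<inter> (+) l ` B) \<partial>count_space \<Lambda>)"
    proof (rule emeasure_UN_countable)
      show "A \<inter> (+) l ` B \<in> sets \<mu>" for l
        using A B by (auto simp: fundamental_domain_def sets intro: translate_borel)
      show "disjoint_family_on (\<lambda>l. A \<inter> (+) l ` B) \<Lambda>"
        unfolding disjoint_family_on_def
      proof (intro ballI impI, rule ccontr)
        fix l m assume lm: "l \<in> \<Lambda>" "m \<in> \<Lambda>" "l \<noteq> m" "A \<inter> (+) l ` B \<inter> (A \<inter> (+) m ` B) \<noteq> {}"
        then obtain b c where bc: "b \<in> B" "c \<in> B" "l + b = m + c" by blast
        have "l + b - b = l" by simp
        moreover have "l + b - c = m" using bc(3) by simp
        ultimately have "l + b - b \<in> \<Lambda>" "l + b - c \<in> \<Lambda>" using lm(1,2) by simp_all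
        then have "b = c" using B bc(1,2) unfolding fundamental_domain_def by blast
        then show False using lm(3) bc(3) by simp
      qed
    qed (rule assms(2))
    ultimately show ?thesis by simp
  qed
  have "emeasure \<mu> D = (\<integral>\<^sup>+l. emeasure \<mu> (D \<inter> (+) l ` E) \<partial>count_space \<Lambda>)"
    by (rule decomp) fact+
  also have "\<dots> = (\<integral>\<^sup>+l. emeasure \<mu> (E \<inter> (+) (- l) ` D) \<partial>count_space \<Lambda>)"
  proof (rule nn_integral_cong)
    fix l
    have "E \<inter> (+) (- l) ` D = (+) (- l) ` (D \<inter> (+) l ` E)" unfolding translate_eq_vimage by auto
    moreover have "D \<inter> (+) l ` E \<in> sets borel"
      using assms by (auto simp: fundamental_domain_def intro: translate_borel)
    ultimately show "emeasure \<mu> (D \<inter> (+) l ` E) = emeasure \<mu> (E \<inter> (+) (- l) ` D)"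
      by (simp only: inv)
  qed
  also have "\<dots> = (\<integral>\<^sup>+l. emeasure \<mu> (E \<inter> (+) l ` D) \<partial>count_space \<Lambda>)"
  proof -
    have "bij_betw uminus \<Lambda> \<Lambda>"
      by (rule bij_betwI[where g = uminus]) (auto simp: assms(3))
    from nn_integral_bij_count_space[OF this, of "\<lambda>l. emeasure \<mu> (E \<inter> (+) l ` D)"]
    show ?thesis .
  qed
  also have "\<dots> = emeasure \<mu> E" by (rule decomp[symmetric]) fact+
  finally show ?thesis .
qed

lemma has_covolume_param_stab_d_mat:
  fixes \<mu> :: "'a::{field,finite} fls measure"
  assumes "normalized_haar \<mu>" "r \<noteq> 0"
  shows "has_covolume \<mu> (param_stab (d_mat r)) c \<longleftrightarrow> c = ennreal (real CARD('a) powi (2 * fls_subdegree r - 1))"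
proof -
  let ?L = "param_stab (d_mat r)" and ?I = "frac_ideal (1 - 2 * fls_subdegree r)"
  have I: "fundamental_domain ?L ?I"
    unfolding fundamental_domain_def
    by (auto intro: borel_open open_frac_ideal simp: param_stab_complement[OF assms(2)])
  have "?L \<subseteq> (\<lambda>p. p / r\<^sup>2) ` poly_ring"
    using assms(2) by (auto simp: param_stab_d_mat intro!: image_eqI[of x _ "r\<^sup>2 * x" for x])
  then have count: "countable ?L"
    by (rule countable_subset) (intro countable_image countable_poly_ring)
  have "emeasure \<mu> D = emeasure \<mu> ?I" if "fundamental_domain ?L D" for D
    by (rule emeasure_fundamental_domain_unique[OF assms(1) count _ that I])
       (simp add: param_stab_d_mat[OF assms(2)])
  then have "has_covolume \<mu> ?L c \<longleftrightarrow> c = emeasure \<mu> ?I"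
    unfolding has_covolume_def using I by metis
  then show ?thesis by (simp add: emeasure_frac_ideal[OF assms(1)])
qed

lemma ennreal_card_powi_eq_iff:
  "ennreal (real CARD('a::{field,finite}) powi a) = ennreal (real CARD('a) powi b) \<longleftrightarrow> a = b"
proof -
  have q: "1 < real CARD('a)" using card_field_ge_2[where 'a = 'a] by simp
  then have "real CARD('a) powi a < real CARD('a) powi b" if "a < b" for a b
    using that by (rule power_int_strict_increasing[rotated])
  then have "real CARD('a) powi a = real CARD('a) powi b \<longleftrightarrow> a = b"
    by (metis linorder_neqE less_irrefl)
  then show ?thesis using q by simp
qed

section \<open>The distribution of the height\<close>

lemma u_mat_in_K: "u_mat s \<in> SL2 integers_O \<longleftrightarrow> s \<in> integers_O"
  by (simp add: u_mat_def mat2_in_SL2_iff integers_O_eq)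

lemma height_level_set_measurable:
  assumes "U_invariant_prob (U_orbit g) \<nu>" "g \<in> G" "w \<in> G"
  shows "{y \<in> U_orbit g. height_K (right_act y w) \<in> A} \<in> sets \<nu>"
proof -
  have "openin X_top {x \<in> coset ` G. height_K (right_act x w) \<in> A}"
    by (rule openin_X_top_K_invariant[OF assms(3)]) (simp add: height_K_mult_K)
  moreover have "U_orbit g \<subseteq> coset ` G" using assms(2) by (auto simp: U_orbit_def G_mult)
  ultimately have "openin (subtopology X_top (U_orbit g)) {y \<in> U_orbit g. height_K (right_act y w) \<in> A}"
    unfolding openin_subtopology by blast
  then show ?thesis using assms(1) by (auto simp: U_invariant_prob_def)
qed

text \<open>
  Each translate of the level set by an element of \<open>R\<close> has the same measure, and by hypothesis every
  point of the orbit lies in exactly \<open>c\<close> of these translates.  Integrating the sum of their indicator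
  functions computes their total measure in two ways.
\<close>

lemma invariant_prob_counting:
  fixes g :: "'a::field fls^2^2"
  assumes "U_invariant_prob (U_orbit g) \<nu>" "g \<in> G" "finite R"
    "\<And>t. card {s \<in> R. height_K (coset (g ** u_mat (t - s))) \<in> A} = c"
  shows "of_nat (card R) * emeasure \<nu> {y \<in> U_orbit g. height_K y \<in> A} = of_nat c"
proof -
  interpret prob_space \<nu> using assms(1) by (simp add: U_invariant_prob_def)
  have space: "space \<nu> = U_orbit g" using assms(1) by (simp add: U_invariant_prob_def)
  let ?S = "{y \<in> U_orbit g. height_K y \<in> A}"
  let ?T = "\<lambda>s. {y \<in> U_orbit g. height_K (right_act y (u_mat (- s))) \<in> A}"
  have act: "right_act (coset (g ** u_mat t)) (u_mat s) = coset (g ** u_mat (t + s))" for t s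
    by (simp add: right_act_coset u_mat_add matrix_mul_assoc[symmetric])
  have T: "?T s \<in> sets \<nu>" for s by (rule height_level_set_measurable[OF assms(1,2)]) simp
  have S: "?S \<in> sets \<nu>"
    using T[of 0] by (simp add: right_act_def)
  have "(\<lambda>x. right_act x (u_mat s)) ` ?S = ?T s" for s
  proof (intro equalityI subsetI)
    fix y assume "y \<in> ?T s"
    then obtain t where t: "y = coset (g ** u_mat t)" "height_K (coset (g ** u_mat (t - s))) \<in> A"
      by (auto simp: U_orbit_def act)
    have "y = right_act (coset (g ** u_mat (t - s))) (u_mat s)" by (simp add: act t(1))
    then show "y \<in> (\<lambda>x. right_act x (u_mat s)) ` ?S" using t(2) by (auto simp: U_orbit_def)
  qed (auto simp: U_orbit_def act)
  moreover have "emeasure \<nu> ((\<lambda>x. right_act x (u_mat s)) ` ?S) = emeasure \<nu> ?S" for s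
    using assms(1) S by (simp add: U_invariant_prob_def)
  ultimately have "emeasure \<nu> (?T s) = emeasure \<nu> ?S" for s by simp
  then have "of_nat (card R) * emeasure \<nu> ?S = (\<Sum>s\<in>R. emeasure \<nu> (?T s))" by simp
  also have "\<dots> = (\<Sum>s\<in>R. \<integral>\<^sup>+y. indicator (?T s) y \<partial>\<nu>)" using T by simp
  also have "\<dots> = (\<integral>\<^sup>+y. (\<Sum>s\<in>R. indicator (?T s) y) \<partial>\<nu>)"
    using T by (intro nn_integral_sum[symmetric]) simp
  also have "\<dots> = (\<integral>\<^sup>+y. of_nat c \<partial>\<nu>)"
  proof (rule nn_integral_cong)
    fix y assume "y \<in> space \<nu>"
    then obtain t where y: "y = coset (g ** u_mat t)" by (auto simp: space U_orbit_def)
    have "(\<Sum>s\<in>R. indicator (?T s) y :: ennreal) = (\<Sum>s\<in>R. if height_K (coset (g ** u_mat (t - s))) \<in> A then 1 else 0)"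
      by (intro sum.cong) (auto simp: indicator_def y act U_orbit_def)
    also have "\<dots> = of_nat (card {s \<in> R. height_K (coset (g ** u_mat (t - s))) \<in> A})"
      using assms(3) by (simp add: sum.If_cases Int_def)
    finally show "(\<Sum>s\<in>R. indicator (?T s) y :: ennreal) = of_nat c" by (simp add: assms(4))
  qed
  also have "\<dots> = of_nat c" by (simp add: emeasure_space_1)
  finally show ?thesis .
qed

text \<open>
  Supplies the count required by \<open>invariant_prob_counting\<close>.  The height at parameter \<open>t - s\<close> depends only on the
  class of \<open>t\<close> modulo the stabilizer and \<open>O\<close>, so \<open>t\<close> may be replaced by some \<open>x\<close> in \<open>R\<close>, and
  \<open>s \<mapsto> x - s\<close> is an involution of \<open>R\<close>.
\<close>

lemma card_height_translate:
  assumes "g \<in> G" "\<And>x y. x \<in> R \<Longrightarrow> y \<in> R \<Longrightarrow> x - y \<in> R"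
    "\<And>t. \<exists>x\<in>R. \<exists>y\<in>param_stab g. t - x - y \<in> integers_O"
  shows "card {s \<in> R. height_K (coset (g ** u_mat (t - s))) \<in> A} = card {s \<in> R. height_K (coset (g ** u_mat s)) \<in> A}"
proof -
  obtain x y where xy: "x \<in> R" "y \<in> param_stab g" "t - x - y \<in> integers_O" using assms(3) by blast
  have "height_K (coset (g ** u_mat (t - s))) = height_K (coset (g ** u_mat (x - s)))" for s
  proof -
    have "coset (g ** u_mat (t - s)) = coset (g ** u_mat ((x - s) + (t - x - y)))"
      by (simp add: coset_u_mat_eq_iff xy(2))
    also have "\<dots> = coset ((g ** u_mat (x - s)) ** u_mat (t - x - y))"
      by (simp add: u_mat_add matrix_mul_assoc[symmetric])
    finally show ?thesis
      using height_K_mult_K[of "g ** u_mat (x - s)" "u_mat (t - x - y)"] xy(3) assms(1)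
      by (simp add: u_mat_in_K G_mult)
  qed
  then show ?thesis
    using xy(1) assms(2)
    by (intro bij_betw_same_card[of "\<lambda>s. x - s"] bij_betwI[where g = "\<lambda>s. x - s"]) auto
qed

lemma d_mat_mult: "d_mat (x * y) = d_mat x ** d_mat y"
  by (simp add: d_mat_def)

lemma a_mat_eq_d_mat: "a_mat m = d_mat (tvar powi m)"
  by (simp add: a_mat_def d_mat_def power_int_minus)

lemma d_mat_u_mat_commute: "y \<noteq> 0 \<Longrightarrow> d_mat y ** u_mat (inverse (y\<^sup>2) * s) = u_mat s ** d_mat y"
  by (simp add: d_mat_def u_mat_def power2_eq_square field_simps)

text \<open>
  The group \<open>R m\<close> of the polynomials in \<open>t\<close> of degree at most \<open>2 \<bar>m\<bar> + 1\<close> without constant term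
  represents all classes modulo \<open>t\<^sup>-\<^sup>2\<^sup>m P + O\<close>, because \<open>F\<close> is the sum of \<open>t\<^sup>-\<^sup>2\<^sup>m P\<close> and
  \<open>frac_ideal (1 + 2 m)\<close> and the degree bound reaches down to that ball.  The unit \<open>\<eta>\<close> has
  disappeared from the right-hand side, which allows the comparison with \<open>a_mat m\<close>.
\<close>

lemma height_counting_formula:
  fixes \<eta> :: "'a::{field,finite} fls"
  defines "R \<equiv> \<lambda>m. {x::'a fls. \<forall>k. k \<notin> {- (2 * \<bar>m\<bar> + 1)..- 1} \<longrightarrow> fls_nth x k = 0}"
  assumes "\<eta> \<noteq> 0" "fls_subdegree \<eta> = 0" "U_invariant_prob (U_orbit (d_mat (tvar powi m * \<eta>))) \<nu>"
  shows "of_nat (card (R m)) * emeasure \<nu> {y \<in> U_orbit (d_mat (tvar powi m * \<eta>)). height_K y \<in> A} =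
    of_nat (card {s \<in> R m. height_K (coset (a_mat m ** u_mat s)) \<in> A})"
proof -
  define r where "r = tvar powi m * \<eta>"
  define e where "e = inverse (\<eta>\<^sup>2)"
  have r: "r \<noteq> 0" "fls_subdegree r = - m"
    using assms by (simp_all add: r_def)
  have e: "e \<noteq> 0" "fls_subdegree e = 0" using assms by (simp_all add: e_def power2_eq_square)
  \<comment> \<open>Multiplication by \<open>e\<close> turns the parameters of the orbit of \<open>a_mat m\<close> into those of the orbit of
    \<open>d_mat r\<close>.\<close>
  define S where "S = (*) e ` R m"
  have finR: "finite (R m)" unfolding R_def by (rule finite_window)
  have inj: "inj_on ((*) e) X" for X using e(1) by (simp add: inj_on_def)
  have Seq: "s \<in> S \<longleftrightarrow> s / e \<in> R m" for s
    using e(1) by (auto simp: S_def intro!: image_eqI[of _ _ "s / e"])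
  have height_eq: "height_K (coset (d_mat r ** u_mat (e * s))) = height_K (coset (a_mat m ** u_mat s))" for s
  proof -
    have "d_mat r ** u_mat (e * s) = (a_mat m ** u_mat s) ** d_mat \<eta>"
      using assms(2) by (simp add: r_def e_def d_mat_mult a_mat_eq_d_mat d_mat_u_mat_commute matrix_mul_assoc[symmetric])
    moreover have "d_mat \<eta> \<in> SL2 integers_O"
      using assms(2,3) by (simp add: d_mat_def mat2_in_SL2_iff integers_O_eq frac_ideal_iff)
    ultimately show ?thesis by (simp add: height_K_mult_K G_mult)
  qed
  have "of_nat (card S) * emeasure \<nu> {y \<in> U_orbit (d_mat r). height_K y \<in> A} =
      of_nat (card {s \<in> S. height_K (coset (d_mat r ** u_mat s)) \<in> A})"
  proof (rule invariant_prob_counting)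
    show "finite S" by (simp add: S_def finR)
    show "U_invariant_prob (U_orbit (d_mat r)) \<nu>" using assms(4) by (simp add: r_def)
    show "d_mat r \<in> G" using r by simp
    fix t
    show "card {s \<in> S. height_K (coset (d_mat r ** u_mat (t - s))) \<in> A} =
        card {s \<in> S. height_K (coset (d_mat r ** u_mat s)) \<in> A}"
    proof (rule card_height_translate)
      show "d_mat r \<in> G" by fact
      show "x - y \<in> S" if "x \<in> S" "y \<in> S" for x y
        using that by (simp add: Seq R_def diff_divide_distrib)
      fix t
      obtain f where f: "f \<in> frac_ideal (1 + 2 * m)" "t - f \<in> param_stab (d_mat r)"
        using param_stab_complement[OF r(1), of t] by (auto simp: r(2))
      define h where "h = f / e"
      have h: "h \<in> frac_ideal (1 + 2 * m)" "f = e * h"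
        using f(1) frac_ideal_mult_iff[OF e(1), of h "1 + 2 * m"] e by (simp_all add: h_def)
      \<comment> \<open>The integral part of \<open>h\<close>; what remains has only the coefficients allowed in \<open>R m\<close>.\<close>
      define o' where "o' = fps_to_fls (fls_regpart h)"
      have "h - o' \<in> R m"
        using h(1) by (auto simp: R_def o'_def frac_ideal_def)
      moreover have "o' \<in> frac_ideal 0" by (simp add: frac_ideal_def o'_def)
      ultimately have "e * (h - o') \<in> S" "e * o' \<in> integers_O"
        using e frac_ideal_mult_iff[OF e(1), of o' 0] by (simp_all add: Seq integers_O_eq)
      moreover have "t - e * (h - o') - (t - f) = e * o'" by (simp add: h(2) algebra_simps)
      ultimately show "\<exists>x\<in>S. \<exists>y\<in>param_stab (d_mat r). t - x - y \<in> integers_O"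
        using f(2) by metis
    qed
  qed
  moreover have "card S = card (R m)" unfolding S_def by (rule card_image[OF inj])
  moreover have "{s \<in> S. height_K (coset (d_mat r ** u_mat s)) \<in> A} =
      (*) e ` {s \<in> R m. height_K (coset (a_mat m ** u_mat s)) \<in> A}"
    unfolding S_def by (auto simp: height_eq)
  ultimately show ?thesis by (simp add: card_image[OF inj] r_def)
qed

lemma height_distribution_eq:
  fixes \<eta> :: "'a::{field,finite} fls"
  assumes "\<eta> \<noteq> 0" "fls_subdegree \<eta> = 0"
    "U_invariant_prob (U_orbit (d_mat (tvar powi m * \<eta>))) \<nu>" "U_invariant_prob (U_orbit (a_mat m :: 'a fls^2^2)) \<nu>'"
  shows "distr \<nu> (count_space UNIV) height_K = distr \<nu>' (count_space UNIV) height_K"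
proof -
  have em: "emeasure (distr \<rho> (count_space UNIV) height_K) A = emeasure \<rho> {y \<in> U_orbit g. height_K y \<in> A}"
    if \<rho>: "U_invariant_prob (U_orbit g) \<rho>" "g \<in> G" for \<rho> A and g :: "'a fls^2^2"
  proof -
    have space: "space \<rho> = U_orbit g" using \<rho> by (simp add: U_invariant_prob_def)
    have pre: "height_K -` B \<inter> space \<rho> = {y \<in> U_orbit g. height_K y \<in> B}" for B by (auto simp: space)
    have "{y \<in> U_orbit g. height_K y \<in> B} \<in> sets \<rho>" for B
      using height_level_set_measurable[OF \<rho> mat_1_in_SL2[OF is_subring_UNIV], of B] by (simp add: right_act_def)
    then have "height_K \<in> measurable \<rho> (count_space UNIV)" by (simp add: measurable_def pre)
    then show ?thesis by (simp add: emeasure_distr pre)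
  qed
  define R where "R = {x::'a fls. \<forall>k. k \<notin> {- (2 * \<bar>m\<bar> + 1)..- 1} \<longrightarrow> fls_nth x k = 0}"
  have "finite R" unfolding R_def by (rule finite_window)
  moreover have "0 \<in> R" by (simp add: R_def)
  ultimately have "card R \<noteq> 0" by auto
  show ?thesis
  proof (rule measure_eqI)
    fix A
    have "of_nat (card R) * emeasure (distr \<nu> (count_space UNIV) height_K) A =
        of_nat (card {s \<in> R. height_K (coset (a_mat m ** u_mat s)) \<in> A})"
      using height_counting_formula[OF assms(1-3), of A] assms(1) by (simp add: R_def em[OF assms(3)])
    moreover have "of_nat (card R) * emeasure (distr \<nu>' (count_space UNIV) height_K) A =
        of_nat (card {s \<in> R. height_K (coset (a_mat m ** u_mat s)) \<in> A})"
      using height_counting_formula[of 1 m \<nu>' A] assms(4) by (simp add: R_def em[OF assms(4)] a_mat_eq_d_mat)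
    ultimately show "emeasure (distr \<nu> (count_space UNIV) height_K) A = emeasure (distr \<nu>' (count_space UNIV) height_K) A"
      using \<open>card R \<noteq> 0\<close> ennreal_mult_cancel_left[of "of_nat (card R)"] by fastforce
  qed simp
qed

section \<open>Compact horocyclic orbits\<close>

theorem proposition4p1:
  fixes g :: "'a::{field,finite} fls^2^2"
    and \<mu> :: "'a fls measure"
  assumes haar: "normalized_haar \<mu>"
    and g: "g \<in> G"
  shows "(compactin X_top (U_orbit g) \<longleftrightarrow> proj_act g proj_infty \<in> proj_line rat_field) \<and>
    (compactin X_top (U_orbit g) \<longrightarrow>
      (\<forall>g'\<in>G. coset g' \<in> U_orbit g \<longrightarrow> param_stab g' = param_stab g) \<and>
      (\<exists>m::int.
        (\<forall>n::int. has_covolume \<mu> (param_stab g) (ennreal (real CARD('a) powi (- 2 * n - 1)))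
           \<longleftrightarrow> n = m) \<and>
        (\<forall>\<nu> \<nu>'. U_invariant_prob (U_orbit g) \<nu> \<and> U_invariant_prob (U_orbit (a_mat m :: 'a fls^2^2)) \<nu>' \<longrightarrow>
           distr \<nu> (count_space UNIV) height_K = distr \<nu>' (count_space UNIV) height_K) \<and>
        (\<exists>\<gamma>\<in>Gam. \<exists>r \<eta> s\<^sub>0. r \<noteq> 0 \<and> \<eta> \<in> ring_units integers_O \<and>
           matrix_inv \<gamma> ** g = d_mat r ** u_mat s\<^sub>0 \<and>
           d_mat r ** u_mat s\<^sub>0 = a_mat m ** d_mat \<eta> ** u_mat s\<^sub>0 \<and>
           m = - fls_subdegree r)))"
proof (intro conjI impI)
  show "compactin X_top (U_orbit g) \<longleftrightarrow> proj_act g proj_infty \<in> proj_line rat_field"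
  proof
    assume "proj_act g proj_infty \<in> proj_line rat_field"
    then obtain \<gamma> r s\<^sub>0 where d: "\<gamma> \<in> Gam" "r \<noteq> 0" "adj \<gamma> ** g = d_mat r ** u_mat s\<^sub>0"
      by (rule rational_decomposition[OF g])
    have "U_orbit g = U_orbit (d_mat r)"
      using U_orbit_cong[OF adj_mult_eq_imp_coset_eq[OF d(1,3)]] by (simp add: U_orbit_mult_u_mat)
    then show "compactin X_top (U_orbit g)" using compact_U_orbit_d_mat[OF d(2)] by simp
  qed (rule compact_orbit_rational[OF g])
next
  show "\<forall>g'\<in>G. coset g' \<in> U_orbit g \<longrightarrow> param_stab g' = param_stab g"
    using param_stab_base_point by blast
next
  assume "compactin X_top (U_orbit g)"
  then obtain \<gamma> r s\<^sub>0 where d: "\<gamma> \<in> Gam" "r \<noteq> 0" "adj \<gamma> ** g = d_mat r ** u_mat s\<^sub>0"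
    using rational_decomposition[OF g] compact_orbit_rational[OF g] by metis
  define m where "m = - fls_subdegree r"
  define \<eta> where "\<eta> = r / tvar powi m"
  have \<eta>: "\<eta> \<noteq> 0" "fls_subdegree \<eta> = 0" "r = tvar powi m * \<eta>"
    using d(2) by (simp_all add: \<eta>_def fls_divide_subdegree m_def)
  have cos: "coset g = coset (d_mat r ** u_mat s\<^sub>0)" by (rule adj_mult_eq_imp_coset_eq[OF d(1,3)])
  have orbit: "U_orbit g = U_orbit (d_mat (tvar powi m * \<eta>))"
    using U_orbit_cong[OF cos] by (simp add: U_orbit_mult_u_mat \<eta>(3)[symmetric])
  have stab: "param_stab g = param_stab (d_mat r)"
    using param_stab_cong[OF cos] by (simp add: param_stab_mult_u_mat)
  show "\<exists>m::int.
        (\<forall>n::int. has_covolume \<mu> (param_stab g) (ennreal (real CARD('a) powi (- 2 * n - 1)))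
           \<longleftrightarrow> n = m) \<and>
        (\<forall>\<nu> \<nu>'. U_invariant_prob (U_orbit g) \<nu> \<and> U_invariant_prob (U_orbit (a_mat m :: 'a fls^2^2)) \<nu>' \<longrightarrow>
           distr \<nu> (count_space UNIV) height_K = distr \<nu>' (count_space UNIV) height_K) \<and>
        (\<exists>\<gamma>\<in>Gam. \<exists>r \<eta> s\<^sub>0. r \<noteq> 0 \<and> \<eta> \<in> ring_units integers_O \<and>
           matrix_inv \<gamma> ** g = d_mat r ** u_mat s\<^sub>0 \<and>
           d_mat r ** u_mat s\<^sub>0 = a_mat m ** d_mat \<eta> ** u_mat s\<^sub>0 \<and>
           m = - fls_subdegree r)"
  proof (intro exI[of _ m] conjI allI impI)
    show "has_covolume \<mu> (param_stab g) (ennreal (real CARD('a) powi (- 2 * n - 1))) \<longleftrightarrow> n = m" for n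
      unfolding stab has_covolume_param_stab_d_mat[OF haar d(2)] ennreal_card_powi_eq_iff
      by (auto simp: m_def)
    show "distr \<nu> (count_space UNIV) height_K = distr \<nu>' (count_space UNIV) height_K"
      if "U_invariant_prob (U_orbit g) \<nu> \<and> U_invariant_prob (U_orbit (a_mat m :: 'a fls^2^2)) \<nu>'" for \<nu> \<nu>'
      using that height_distribution_eq[OF \<eta>(1,2)] unfolding orbit by blast
    have "d_mat r ** u_mat s\<^sub>0 = a_mat m ** d_mat \<eta> ** u_mat s\<^sub>0"
      by (simp add: \<eta>(3) d_mat_mult a_mat_eq_d_mat)
    then show "\<exists>\<gamma>\<in>Gam. \<exists>r \<eta> s\<^sub>0. r \<noteq> 0 \<and> \<eta> \<in> ring_units integers_O \<and>
           matrix_inv \<gamma> ** g = d_mat r ** u_mat s\<^sub>0 \<and>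
           d_mat r ** u_mat s\<^sub>0 = a_mat m ** d_mat \<eta> ** u_mat s\<^sub>0 \<and>
           m = - fls_subdegree r"
      using d \<eta>(1,2) m_def matrix_inv_SL2[OF d(1)] ring_units_O_iff by metis
  qed
qed

end
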